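(* Let $\lambda$ and $\mu$ be integer partitions. Then $P_\lambda(x)=P_\mu(x)$ if and only if $\lambda\sim\mu$.
   Context: A partition $\lambda=(1^{s_1},2^{s_2},\ldots)$ is described by the multiplicities $s_d(\lambda)\ge 0$ of its parts of size $d$ (only finitely many nonzero). For an integer $m\ge 0$ and a number $v$, the generalized Hermite polynomial is $$\operatorname{He}_m^{[-v]}(y)=\sum_{j=0}^{\lfloor m/2\rfloor}\binom{m}{2j}(2j-1)!!\,v^j\,y^{m-2j},\qquad (-1)!!=1.$$ The partition polynomial (twisted Foulkes character polynomial) of $\lambda$ is $$P_\lambda(x)=\prod_{\substack{d\ge 1\\ d\text{ even}}}\operatorname{He}_{s_d(\lambda)}^{[-d]}(1-x^d)\;\prod_{\substack{d\ge 1\\ d\text{ odd}}}\operatorname{He}_{s_d(\lambda)}^{[-d]}(x^d)$$ (a finite product, since factors with $s_d(\lambda)=0$ equal $1$). Operation 1: suppose a partition contains distinct odd parts $a_1,\ldots,a_r$, each with multiplicity exactly one, and does not contain the distinct odd parts $b_1,\ldots,b_s$, where $\sum_{i=1}^r a_i=\sum_{j=1}^s b_j$. Remove the parts $a_1,\ldots,a_r$ and insert the parts $b_1,\ldots,b_s$ (each once). Operation 2: suppose a partition contains exactly one part of size $4$, no parts of size $2$ and no parts of size $1$. Replace the part $4$ by the parts $2,1,1$. The relation $\sim$ is the smallest equivalence relation on partitions such that $\lambda\sim\mu$ whenever $\mu$ is obtained from $\lambda$ by Operation 1 or Operation 2. *)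

theory Defs
  imports "HOL-Library.Multiset" "HOL-Computational_Algebra.Polynomial"
begin

text \<open>An integer partition is the multiset of its parts; the multiplicity of the part
  \<open>d\<close> in \<open>p\<close> is \<open>count p d\<close>.  The empty partition of 0 is included.\<close>

definition is_partition :: "nat multiset \<Rightarrow> bool" where
  "is_partition p \<longleftrightarrow> 0 \<notin># p"

text \<open>The double factorial \<open>(2j - 1)!! = 1 * 3 * ... * (2j - 1)\<close>, equal to 1 for \<open>j = 0\<close>.\<close>

definition odd_double_fact :: "nat \<Rightarrow> nat" where
  "odd_double_fact j = (\<Prod>i<j. 2 * i + 1)"

text \<open>\<open>hermite_neg m v\<close> is the polynomial written \<open>He\<^sub>m\<close> with superscript \<open>[-v]\<close>: the minus
  sign of the superscript is built into the name, so all signs in the sum are positive.\<close>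

definition hermite_neg :: "nat \<Rightarrow> 'a::comm_semiring_1 \<Rightarrow> 'a poly" where
  "hermite_neg m v =
     (\<Sum>j = 0..m div 2. monom (of_nat (m choose (2 * j)) * of_nat (odd_double_fact j) * v ^ j) (m - 2 * j))"

text \<open>\<open>pcompose\<close> substitutes its second argument for the indeterminate of its first.  The products range over
  the sizes occurring in the partition; all other factors equal 1.\<close>

definition partition_poly :: "nat multiset \<Rightarrow> int poly" where
  "partition_poly p =
     (\<Prod>d \<in> {d \<in> set_mset p. even d}. pcompose (hermite_neg (count p d) (int d)) (1 - monom 1 d)) *
     (\<Prod>d \<in> {d \<in> set_mset p. odd d}. pcompose (hermite_neg (count p d) (int d)) (monom 1 d))"

definition operation1 :: "nat multiset \<Rightarrow> nat multiset \<Rightarrow> bool" where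
  "operation1 p q \<longleftrightarrow> is_partition p \<and>
     (\<exists>A B. finite A \<and> finite B \<and>
        (\<forall>a\<in>A. odd a \<and> count p a = 1) \<and>
        (\<forall>b\<in>B. odd b \<and> count p b = 0) \<and>
        \<Sum>A = \<Sum>B \<and>
        q = p - mset_set A + mset_set B)"

definition operation2 :: "nat multiset \<Rightarrow> nat multiset \<Rightarrow> bool" where
  "operation2 p q \<longleftrightarrow> is_partition p \<and>
     count p 4 = 1 \<and> count p 2 = 0 \<and> count p 1 = 0 \<and>
     q = p - {#4#} + {#2, 1, 1#}"

text \<open>Both operations relate partitions to partitions only (a part 0 is never inserted), so the
  equivalence closure on the whole type restricts on partitions to the smallest equivalence
  relation on partitions containing the operations.\<close>

definition partition_equiv :: "nat multiset \<Rightarrow> nat multiset \<Rightarrow> bool" (infix "\<sim>\<^sub>p" 50) where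
  "p \<sim>\<^sub>p q \<longleftrightarrow> equivclp (\<lambda>r s. operation1 r s \<or> operation2 r s) p q"

end

theory Submission
  imports Defs "HOL-Computational_Algebra.Polynomial_Factorial"
    "HOL-Computational_Algebra.Fundamental_Theorem_Algebra"
begin

text \<open>
  Each operation preserves the polynomial: single parts of odd sizes contribute only the power of \<open>x\<close>
  whose exponent is their sum, and \<open>1 - x^4 = (1 - x\<^sup>2) (1 + x\<^sup>2)\<close> is the contribution of \<open>2, 1, 1\<close> as well as that of \<open>4\<close>.

  For the converse, write the polynomial as \<open>A B\<close> with \<open>A\<close> the product over the odd and \<open>B\<close> the product over
  the even sizes.  The zeros of the Hermite polynomials are purely imaginary.  So at a zero \<open>z\<close> of \<open>A\<close> some \<open>z^d\<close> with odd
  \<open>d\<close> is imaginary, while at a zero of \<open>B\<close> some \<open>z^e\<close> with even \<open>e\<close> has real part 1.  Both together give an algebraic equation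
  for \<open>(1 - z^e)\<^sup>2\<close> that a parity argument refutes, unless \<open>z\<^sup>2 = -1\<close> and \<open>d = 1\<close> (\<open>common_zero\<close>).  Hence an
  equality \<open>A B = A' B'\<close> forces \<open>A = A'\<close> and \<open>B = B'\<close>, or it moves one factor \<open>x\<^sup>2 + 1\<close> from the odd to the even
  side (\<open>odd_even_separation\<close>); it is only one because the zeros of Hermite polynomials are simple.

  From \<open>B\<close> alone the multiplicities can be read off: seen from its leading term, a product over sizes \<open>d\<close> is
  triangular, and \<open>m\<close> parts of even size \<open>d\<close> enter with \<open>- m\<close> at distance \<open>d\<close> from the top.  From \<open>A\<close>, \<open>k\<close> parts of
  odd size \<open>d\<close> enter with \<open>d (k choose 2)\<close> at distance \<open>2 d\<close>, which determines \<open>k\<close> up to the ambiguity between 0 and 1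
  (\<open>even_multiplicities_determined\<close>, \<open>odd_multiplicities_determined\<close>).  That ambiguity is what the first
  operation provides for, and the equality of sums that it demands is the equality of degrees.

  If a factor \<open>x\<^sup>2 + 1\<close> has moved, the same coefficients show that one partition has two parts of size 1, the other
  at most one, and that the multiplicities of size 2 differ by 1.  To exclude everything but 1 and 0 there, the lowest terms
  of \<open>B\<close> are used: they involve the Hermite values at 1, which are controlled modulo 4 (\<open>hermite_value_ratio\<close>,
  \<open>smallest_even_multiplicity\<close>).  Size 4 is treated in the same way, and the second operation removes
  the difference.
\<close>

section \<open>Recurrence and derivative of the Hermite polynomials\<close>

lemma hermite_neg_eq_sum_atMost:
  assumes "m div 2 \<le> M"
  shows "hermite_neg m v =
    (\<Sum>j\<le>M. monom (of_nat (m choose (2 * j)) * of_nat (odd_double_fact j) * v ^ j) (m - 2 * j))"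
  unfolding hermite_neg_def
proof (rule sum.mono_neutral_left)
  show "\<forall>j\<in>{..M} - {0..m div 2}.
     monom (of_nat (m choose (2 * j)) * of_nat (odd_double_fact j) * v ^ j) (m - 2 * j) = 0"
    by (auto simp: not_le binomial_eq_0)
qed (use assms in auto)

text \<open>Counted combinatorially: a partial matching of \<open>m + 2\<close> points with \<open>j + 1\<close> edges either leaves the last
  point free or joins it to one of the other \<open>m + 1\<close> points.  This is the three-term recurrence of
  the Hermite polynomials on the level of coefficients.\<close>

lemma choose_mult_odd_double_fact_rec:
  "(Suc (Suc m) choose (2 * Suc j)) * odd_double_fact (Suc j) =
     (Suc m choose (2 * Suc j)) * odd_double_fact (Suc j) +
     Suc m * ((m choose (2 * j)) * odd_double_fact j)"
proof -
  have absorb: "(2 * j + 1) * (Suc m choose (2 * j + 1)) = Suc m * (m choose (2 * j))"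
    using Suc_times_binomial[of "2 * j" m] by simp
  have odf: "odd_double_fact (Suc j) = odd_double_fact j * (2 * j + 1)"
    by (simp add: odd_double_fact_def)
  have pascal: "Suc (Suc m) choose (2 * Suc j) =
      (Suc m choose (2 * Suc j)) + (Suc m choose (2 * j + 1))"
    by simp
  have alg: "(x + y) * (o' * (2 * j + 1)) = x * (o' * (2 * j + 1)) + Suc m * (c * o')"
    if "(2 * j + 1) * y = Suc m * c" for x y c o' :: nat
  proof -
    have "(x + y) * (o' * (2 * j + 1)) = x * (o' * (2 * j + 1)) + ((2 * j + 1) * y) * o'"
      by (simp only: algebra_simps)
    then show ?thesis
      by (simp only: that mult.assoc)
  qed
  show ?thesis
    unfolding pascal odf by (rule alg[OF absorb])
qed

lemma hermite_neg_0 [simp]: "hermite_neg 0 v = 1"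
  by (simp add: hermite_neg_def odd_double_fact_def)

lemma hermite_neg_1 [simp]: "hermite_neg (Suc 0) v = monom 1 (Suc 0)"
  by (simp add: hermite_neg_def odd_double_fact_def)

lemma smult_sum_right: "smult a (sum f A) = (\<Sum>x\<in>A. smult a (f x))"
  by (induction A rule: infinite_finite_induct) (simp_all add: smult_add_right)

text \<open>The derivative, the position of the zeros, and the residues of the values at 1 and at the square roots of
  -1 are all drawn from this recurrence.\<close>

lemma hermite_neg_rec:
  "hermite_neg (Suc (Suc m)) v =
     monom 1 1 * hermite_neg (Suc m) v + smult (v * of_nat (Suc m)) (hermite_neg m v)"
proof -
  define c :: "nat \<Rightarrow> nat \<Rightarrow> 'a"
    where "c m j = of_nat (m choose (2 * j)) * of_nat (odd_double_fact j)" for m j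
  have H: "hermite_neg n v = (\<Sum>j\<le>M. monom (c n j * v ^ j) (n - 2 * j))" if "n div 2 \<le> M" for n M
    using hermite_neg_eq_sum_atMost[OF that] by (simp add: c_def)
  have c0: "c n 0 = 1" for n
    by (simp add: c_def odd_double_fact_def)
  have c_rec: "c (Suc (Suc m)) (Suc j) = c (Suc m) (Suc j) + of_nat (Suc m) * c m j" for j
    unfolding c_def of_nat_mult[symmetric] of_nat_add[symmetric]
    by (simp only: choose_mult_odd_double_fact_rec)
  have shift: "monom 1 1 * monom (c (Suc m) j * v ^ j) (Suc m - 2 * j) =
      monom (c (Suc m) j * v ^ j) (Suc (Suc m) - 2 * j)" for j
  proof (cases "2 * j \<le> Suc m")
    case True
    then show ?thesis by (simp add: mult_monom Suc_diff_le)
  next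
    case False
    then have "c (Suc m) j = 0"
      by (simp add: c_def binomial_eq_0 del: binomial_Suc_Suc)
    then show ?thesis by simp
  qed
  have "hermite_neg (Suc (Suc m)) v =
      (\<Sum>j\<le>Suc m. monom (c (Suc (Suc m)) j * v ^ j) (Suc (Suc m) - 2 * j))"
    by (rule H) simp
  also have "\<dots> = monom 1 (Suc (Suc m)) +
      (\<Sum>j\<le>m. monom (c (Suc (Suc m)) (Suc j) * v ^ Suc j) (m - 2 * j))"
    by (simp add: sum.atMost_Suc_shift c0 del: sum.atMost_Suc)
  also have "\<dots> = (monom 1 (Suc (Suc m)) +
      (\<Sum>j\<le>m. monom (c (Suc m) (Suc j) * v ^ Suc j) (m - 2 * j))) +
      (\<Sum>j\<le>m. smult (v * of_nat (Suc m)) (monom (c m j * v ^ j) (m - 2 * j)))"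
    by (simp add: c_rec ring_distribs add_monom[symmetric] sum.distrib smult_monom mult_ac add.assoc)
  also have "monom 1 (Suc (Suc m)) +
      (\<Sum>j\<le>m. monom (c (Suc m) (Suc j) * v ^ Suc j) (m - 2 * j)) =
      (\<Sum>j\<le>Suc m. monom (c (Suc m) j * v ^ j) (Suc (Suc m) - 2 * j))"
    by (simp add: sum.atMost_Suc_shift c0 del: sum.atMost_Suc)
  also have "\<dots> = monom 1 1 * (\<Sum>j\<le>Suc m. monom (c (Suc m) j * v ^ j) (Suc m - 2 * j))"
    by (simp only: sum_distrib_left shift)
  also have "(\<Sum>j\<le>Suc m. monom (c (Suc m) j * v ^ j) (Suc m - 2 * j)) = hermite_neg (Suc m) v"
    by (rule H[symmetric]) simp
  also have "(\<Sum>j\<le>m. smult (v * of_nat (Suc m)) (monom (c m j * v ^ j) (m - 2 * j))) =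
      smult (v * of_nat (Suc m)) (hermite_neg m v)"
    unfolding H[of m m, simplified] by (simp only: smult_sum_right)
  finally show ?thesis .
qed

lemma coeff_hermite_neg:
  "coeff (hermite_neg m v) i =
     (if i \<le> m \<and> even (m - i)
      then of_nat (m choose (m - i)) * of_nat (odd_double_fact ((m - i) div 2)) * v ^ ((m - i) div 2)
      else 0)"
proof -
  let ?c = "\<lambda>j. of_nat (m choose (2 * j)) * of_nat (odd_double_fact j) * v ^ j"
  have *: "coeff (hermite_neg m v) i = (\<Sum>j\<in>{0..m div 2}. if m - 2 * j = i then ?c j else 0)"
    by (simp add: hermite_neg_def coeff_sum)
  show ?thesis
  proof (cases "i \<le> m \<and> even (m - i)")
    case True
    then have "m - 2 * j = i \<longleftrightarrow> j = (m - i) div 2" if "j \<in> {0..m div 2}" for j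
      using that by (auto elim!: evenE)
    then have "coeff (hermite_neg m v) i = (\<Sum>j\<in>{0..m div 2}. if j = (m - i) div 2 then ?c j else 0)"
      unfolding * by (intro sum.cong) auto
    also have "\<dots> = ?c ((m - i) div 2)"
      by (simp add: sum.delta div_le_mono)
    also have "2 * ((m - i) div 2) = m - i"
      using True by (metis dvd_mult_div_cancel)
    finally show ?thesis using True by (simp only: if_True simp_thms)
  next
    case False
    then have "m - 2 * j \<noteq> i" if "j \<in> {0..m div 2}" for j
      using that by auto
    then show ?thesis
      unfolding * if_not_P[OF False] by (intro sum.neutral) simp
  qed
qed

lemma degree_hermite_neg [simp]: "degree (hermite_neg m v) = m"
  for v :: "'a::comm_ring_1"
proof (rule antisym)
  show "degree (hermite_neg m v) \<le> m"
    by (rule degree_le) (simp add: coeff_hermite_neg)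
  show "m \<le> degree (hermite_neg m v)"
    by (rule le_degree) (simp add: coeff_hermite_neg odd_double_fact_def)
qed

lemma monic_hermite_neg [simp]: "coeff (hermite_neg m v) m = 1"
  by (simp add: coeff_hermite_neg odd_double_fact_def)

lemma pderiv_hermite_neg:
  "pderiv (hermite_neg (Suc m) v) = smult (of_nat (Suc m)) (hermite_neg m v)"
  for v :: "'a::idom"
proof (induction m rule: induct_nat_012)
  case 0
  then show ?case by (simp add: pderiv_monom)
next
  case 1
  then show ?case
    by (simp add: hermite_neg_rec pderiv_add pderiv_mult pderiv_monom mult_monom
        pderiv_smult monom_altdef one_pCons pderiv_pCons)
next
  case (ge2 n)
  show ?case
  proof -
    define k :: 'a where "k = of_nat (Suc n)"
    have k: "of_nat (Suc (Suc n)) = 1 + k" "of_nat (Suc (Suc (Suc n))) = 1 + (1 + k)"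
      by (simp_all add: k_def)
    have "pderiv (hermite_neg (Suc (Suc (Suc n))) v) =
        monom 1 1 * smult (1 + k) (hermite_neg (Suc n) v) + hermite_neg (Suc (Suc n)) v +
        smult (v * (1 + k)) (smult k (hermite_neg n v))"
      unfolding hermite_neg_rec[of "Suc n"] pderiv_add pderiv_mult pderiv_smult ge2 k k_def[symmetric]
      by (simp add: pderiv_monom monom_0)
    also have "\<dots> = smult (1 + k) (hermite_neg (Suc (Suc n)) v) + hermite_neg (Suc (Suc n)) v"
      unfolding hermite_neg_rec[of n] k_def[symmetric]
      by (simp add: smult_add_right smult_add_left algebra_simps)
    finally show ?thesis
      unfolding k by (simp only: smult_add_left smult_1_left add_ac)
  qed
qed

lemma poly_hermite_neg_rec:
  "poly (hermite_neg (Suc (Suc m)) v) y =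
     y * poly (hermite_neg (Suc m) v) y + v * of_nat (Suc m) * poly (hermite_neg m v) y"
  for v :: "'a::comm_ring_1"
  by (simp add: hermite_neg_rec poly_monom)

lemma poly_hermite_neg_minus:
  "poly (hermite_neg m v) (-y) = (-1) ^ m * poly (hermite_neg m v) y"
  for v :: "'a::comm_ring_1"
  by (induction m rule: induct_nat_012) (simp_all add: poly_hermite_neg_rec poly_monom algebra_simps)

section \<open>Zeros of the Hermite polynomials\<close>

text \<open>By the recurrence, the ratio \<open>\<rho>\<close> of two consecutive polynomials is replaced by \<open>y + v (m + 1) / \<rho>\<close>
  in the next step, and inversion preserves the right half plane.  So the ratio never leaves
  the half plane, and no polynomial in the sequence can vanish there.\<close>

lemma hermite_neg_right_half_plane:
  fixes y :: complex
  assumes "v > 0" and "Re y > 0"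
  shows "poly (hermite_neg m (of_real v)) y \<noteq> 0 \<and>
    Re (poly (hermite_neg (Suc m) (of_real v)) y / poly (hermite_neg m (of_real v)) y) > 0"
proof (induction m)
  case 0
  then show ?case using assms by (simp add: poly_monom)
next
  case (Suc m)
  define a where "a = poly (hermite_neg m (of_real v)) y"
  define b where "b = poly (hermite_neg (Suc m) (of_real v)) y"
  have IH: "a \<noteq> 0" "Re (b / a) > 0"
    using Suc by (simp_all add: a_def b_def)
  then have b: "b \<noteq> 0" by auto
  have "poly (hermite_neg (Suc (Suc m)) (of_real v)) y / b =
      y + of_real (v * real (Suc m)) * inverse (b / a)"
    unfolding poly_hermite_neg_rec a_def[symmetric] b_def[symmetric]
    using b IH(1) by (simp add: field_simps)
  moreover have "Re (inverse (b / a)) > 0"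
    unfolding inverse_complex.sel using IH(2) by (intro divide_pos_pos add_pos_nonneg) auto
  then have "Re (of_real (v * real (Suc m)) * inverse (b / a)) > 0"
    using assms(1) by (simp only: Re_complex_of_real Im_complex_of_real times_complex.sel mult_zero_left diff_zero)
       (simp add: zero_less_mult_iff)
  ultimately have "Re (poly (hermite_neg (Suc (Suc m)) (of_real v)) y / b) > 0"
    using assms(2) by simp
  with b show ?case by (simp add: b_def)
qed

lemma hermite_neg_zero_imaginary:
  fixes y :: complex
  assumes "poly (hermite_neg m (of_nat d)) y = 0" and "d > 0"
  shows "Re y = 0"
proof (rule ccontr)
  assume "Re y \<noteq> 0"
  then consider "Re y > 0" | "Re (- y) > 0" by fastforce
  then show False
  proof cases
    case 1
    then show False
      using hermite_neg_right_half_plane[of "real d" y m] assms by simp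
  next
    case 2
    then show False
      using hermite_neg_right_half_plane[of "real d" "- y" m] assms
      by (simp add: poly_hermite_neg_minus)
  qed
qed

text \<open>The recurrence can be run backwards, so two consecutive zeros would force the initial polynomial 1 to vanish.
  As the derivative is a multiple of the preceding polynomial, this says that all zeros are simple.\<close>

lemma hermite_neg_no_consecutive_zeros:
  fixes v :: "'a::field_char_0"
  assumes "v \<noteq> 0"
  shows "\<not> (poly (hermite_neg m v) y = 0 \<and> poly (hermite_neg (Suc m) v) y = 0)"
proof (induction m)
  case (Suc m)
  have "of_nat (Suc m) \<noteq> (0::'a)" unfolding of_nat_eq_0_iff by simp
  with Suc assms show ?case
    by (auto simp: poly_hermite_neg_rec simp del: of_nat_Suc)
qed simp

section \<open>Common zeros of integer polynomials\<close>

abbreviation cpoly :: "int poly \<Rightarrow> complex poly" where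
  "cpoly \<equiv> map_poly of_int"

lemma cpoly_add: "cpoly (p + q) = cpoly p + cpoly q"
  by (rule poly_eqI) (simp add: coeff_map_poly)

lemma cpoly_mult: "cpoly (p * q) = cpoly p * cpoly q"
  by (rule poly_eqI) (simp add: coeff_map_poly coeff_mult)

lemma cpoly_smult: "cpoly (smult a p) = smult (of_int a) (cpoly p)"
  by (rule poly_eqI) (simp add: coeff_map_poly)

lemma cpoly_diff: "cpoly (p - q) = cpoly p - cpoly q"
  by (rule poly_eqI) (simp add: coeff_map_poly)

lemma cpoly_prod: "cpoly (prod f A) = (\<Prod>x\<in>A. cpoly (f x))"
  by (induction A rule: infinite_finite_induct) (simp_all add: cpoly_mult)

lemma cpoly_eq_iff: "cpoly p = cpoly q \<longleftrightarrow> p = q"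
  by (auto simp: poly_eq_iff coeff_map_poly)

lemma cpoly_pcompose: "cpoly (pcompose p q) = pcompose (cpoly p) (cpoly q)"
  by (induction p) (simp_all add: pcompose_pCons cpoly_add cpoly_mult map_poly_pCons)

lemma cpoly_hermite_neg: "cpoly (hermite_neg m (of_nat d)) = hermite_neg m (of_nat d)"
  by (rule poly_eqI)
     (simp only: coeff_map_poly of_int_0 coeff_hermite_neg if_distrib[of of_int]
        of_int_mult of_int_power of_int_of_nat_eq)

text \<open>The primitive minimal polynomial of an algebraic number: pseudo-division by an integer polynomial of
  least degree leaves no remainder, and Gauss's lemma on contents removes the denominators that
  pseudo-division introduces.\<close>

lemma root_annihilator:
  assumes "f \<noteq> 0" and "poly (cpoly f) u = 0"
  obtains h where "h \<noteq> 0" "degree h > 0" "\<And>g. poly (cpoly g) u = 0 \<Longrightarrow> h dvd g"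
proof -
  define p where "p = arg_min degree (\<lambda>p. p \<noteq> 0 \<and> poly (cpoly p) u = 0)"
  have p: "p \<noteq> 0 \<and> poly (cpoly p) u = 0"
    unfolding p_def by (rule arg_min_natI[where k = f]) (use assms in blast)
  have least: "degree p \<le> degree r" if "r \<noteq> 0 \<and> poly (cpoly r) u = 0" for r
    unfolding p_def by (rule arg_min_nat_le) (fact that)
  define h where "h = primitive_part p"
  have p_eq: "p = smult (content p) h"
    by (simp add: h_def)
  have h: "h \<noteq> 0" "content h = 1" "degree h = degree p"
    using p by (auto simp: h_def)
  have "cpoly p = smult (of_int (content p)) (cpoly h)"
    by (metis p_eq cpoly_smult)
  with p have hu: "poly (cpoly h) u = 0"
    by auto
  have "degree h > 0"
  proof (rule ccontr)
    assume "\<not> degree h > 0"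
    then obtain c where "h = [:c:]" by (metis degree_eq_zeroE gr0I)
    with hu h(1) show False by (simp add: map_poly_pCons)
  qed
  moreover have "h dvd g" if gu: "poly (cpoly g) u = 0" for g
  proof -
    obtain q r where qr: "pseudo_divmod g h = (q, r)" by fastforce
    define a where "a = lead_coeff h ^ (Suc (degree g) - degree h)"
    have a: "a \<noteq> 0" using h(1) by (simp add: a_def)
    have eq: "smult a g = h * q + r"
      using pseudo_divmod(1)[OF h(1) qr] by (simp add: a_def)
    then have "poly (cpoly (smult a g)) u = poly (cpoly (h * q + r)) u"
      by (simp only:)
    then have "poly (cpoly r) u = 0"
      by (simp add: cpoly_smult cpoly_add cpoly_mult hu gu)
    with pseudo_divmod(2)[OF h(1) qr] least[of r] h(3) have "r = 0" by (metis leD)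
    then have eq': "smult a g = h * q" using eq by simp
    then have "content (smult a g) = content q"
      using h(2) by (simp add: content_mult)
    \<comment> \<open>Gauss: \<open>h\<close> is primitive, so the whole scaling constant sits in the cofactor \<open>q\<close>.\<close>
    moreover have "a dvd content (smult a g)" by simp
    ultimately have "a dvd content q" by simp
    then have "[:a:] dvd q" by (simp add: const_poly_dvd_iff_dvd_content)
    then obtain q' where "q = smult a q'" by (auto elim!: dvdE)
    with eq' have "smult a (g - h * q') = 0" by (simp add: smult_diff_right)
    with a have "g = h * q'" by simp
    then show ?thesis by simp
  qed
  ultimately show ?thesis using that h(1) by blast
qed

text \<open>The hypotheses say that \<open>g\<close> is congruent to a power of the indeterminate modulo 2, while \<open>f\<close>
  does not vanish at 0 modulo 2.  Hence the two are coprime modulo 2.  A common root would give a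
  nonconstant common divisor over the integers, whose leading coefficient is odd because that
  of \<open>g\<close> is, so it would stay nonconstant modulo 2.\<close>

lemma no_common_root_mod_2:
  assumes "poly (cpoly f) u = 0" and "odd (coeff f 0)"
    and "poly (cpoly g) u = 0" and "odd (lead_coeff g)" and "\<And>i. i < degree g \<Longrightarrow> even (coeff g i)"
  shows False
proof -
  have "f \<noteq> 0" using assms(2) by auto
  then obtain h where h: "h \<noteq> 0" "degree h > 0" "h dvd f" "h dvd g"
    using root_annihilator[of f u] assms(1,3) by metis
  then obtain f' k where fk: "f = h * f'" "g = h * k" by (elim dvdE)
  have h0: "odd (coeff h 0)" using assms(2) by (simp add: fk coeff_mult)
  have lk: "odd (lead_coeff k)" using assms(4) by (simp add: fk lead_coeff_mult)
  \<comment> \<open>Modulo 2 the constant term of \<open>h\<close> is 1, so the lowest term of \<open>k\<close> survives in \<open>g = h k\<close>; it must be the only odd term of \<open>g\<close>, the leading one, which is too far up for \<open>k\<close>.\<close>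
  define j where "j = (LEAST j. odd (coeff k j))"
  have j: "odd (coeff k j)" unfolding j_def by (rule LeastI) (fact lk)
  have jd: "j \<le> degree k" unfolding j_def by (rule Least_le) (fact lk)
  have small: "even (coeff k i)" if "i < j" for i
    using not_less_Least that unfolding j_def by blast
  have "coeff g j = coeff h 0 * coeff k j + (\<Sum>i\<in>{..j} - {0}. coeff h i * coeff k (j - i))"
    unfolding fk coeff_mult by (subst sum.remove[of _ 0]) auto
  moreover have "even (\<Sum>i\<in>{..j} - {0}. coeff h i * coeff k (j - i))"
    by (intro dvd_sum) (auto intro!: small)
  ultimately have "odd (coeff g j)" using h0 j by simp
  then have "degree g \<le> j" using assms(5) not_less by blast
  moreover have "degree g = degree h + degree k"
    using h(1) lk unfolding fk by (subst degree_mult_eq) auto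
  ultimately show False using h(2) jd by simp
qed

section \<open>Common zeros of odd and even factors\<close>

text \<open>This splits \<open>(1 + y)\<^sup>n\<close> into its even and odd part as a function of \<open>y\<close>.  The value \<open>n\<close> of the odd
  part at 0 is what enters the parity argument below.\<close>

lemma odd_part_of_binomial_power:
  obtains S T :: "int poly" where "coeff S 0 = int n"
    "\<And>y. (1 + y) ^ n = poly (cpoly T) (y\<^sup>2) + y * poly (cpoly S) (y\<^sup>2)"
proof -
  have "\<exists>S T. coeff S 0 = int n \<and> coeff T 0 = 1 \<and>
    (\<forall>y. (1 + y) ^ n = poly (cpoly T) (y\<^sup>2) + y * poly (cpoly S) (y\<^sup>2))"
  proof (induction n)
    case 0
    show ?case by (rule exI[of _ 0], rule exI[of _ 1]) simp
  next
    case (Suc n)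
    then obtain S T where ST: "coeff S 0 = int n" "coeff T 0 = 1"
      "\<And>y. (1 + y) ^ n = poly (cpoly T) (y\<^sup>2) + y * poly (cpoly S) (y\<^sup>2)" by blast
    have step: "(1 + y) ^ Suc n = (1 + y) * (poly (cpoly T) (y\<^sup>2) + y * poly (cpoly S) (y\<^sup>2))" for y
      by (simp only: power_Suc ST(3))
    show ?case
      unfolding step
      by (rule exI[of _ "S + T"], rule exI[of _ "T + pCons 0 S"])
         (simp add: ST(1,2) cpoly_add map_poly_pCons algebra_simps power2_eq_square)
  qed
  with that show ?thesis by blast
qed

text \<open>Consecutive exponents of a Hermite polynomial differ by 2, and each step down from the leading term brings another
  factor \<open>e\<close>, so the lower coefficients inherit the parity of \<open>e\<close>.\<close>

lemma hermite_neg_in_square: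
  assumes "even e"
  obtains G :: "int poly" where "lead_coeff G = 1" "\<And>i. i < degree G \<Longrightarrow> even (coeff G i)"
    "\<And>y. poly (hermite_neg m (of_nat e)) y = y ^ (m mod 2) * poly (cpoly G) (y\<^sup>2)"
proof -
  define r where "r = m div 2"
  define c where "c j = int ((m choose (2 * j)) * odd_double_fact j * e ^ j)" for j
  define G where "G = (\<Sum>j=0..r. monom (c j) (r - j))"
  have coeff: "coeff G i = (\<Sum>j=0..r. if r - j = i then c j else 0)" for i
    by (simp add: G_def coeff_sum)
  have "coeff G r = (\<Sum>j=0..r. if j = 0 then c j else 0)"
    unfolding coeff by (rule sum.cong) auto
  then have Gr: "coeff G r = 1"
    by (simp add: c_def odd_double_fact_def)
  have "degree G \<le> r"
    by (rule degree_le) (auto simp: coeff intro!: sum.neutral)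
  with Gr have deg: "degree G = r"
    by (metis le_antisym le_degree zero_neq_one)
  have "even (coeff G i)" if "i < r" for i
    unfolding coeff using that assms by (intro dvd_sum) (auto simp: c_def)
  moreover have "poly (hermite_neg m (of_nat e)) y = y ^ (m mod 2) * poly (cpoly G) (y\<^sup>2)" for y
  proof -
    have cG: "cpoly G = (\<Sum>j=0..r. monom (of_int (c j)) (r - j))"
      by (rule poly_eqI) (simp add: coeff coeff_map_poly coeff_sum if_distrib[of of_int] cong: if_cong)
    have "y ^ (m - 2 * j) = y ^ (m mod 2) * (y\<^sup>2) ^ (r - j)" if "j \<in> {0..r}" for j
    proof -
      have "m - 2 * j = m mod 2 + 2 * (r - j)"
        using that by (simp add: r_def) presburger
      then show ?thesis by (simp only: power_add power_mult)
    qed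
    then show ?thesis
      unfolding cG hermite_neg_def r_def[symmetric] poly_sum poly_monom sum_distrib_left
      by (intro sum.cong) (simp_all add: c_def)
  qed
  ultimately show ?thesis
    by (intro that[of G]) (simp_all only: deg Gr)
qed

text \<open>Each step of the recurrence multiplies by \<open>w\<close> and adds a multiple of \<open>d\<close>; since \<open>w\<^sup>2 = -1\<close>, the power of \<open>w\<close> can be
  factored out of the added term.  At a zero the remaining integer factor would vanish, so \<open>d\<close> would divide 1.\<close>

lemma poly_hermite_neg_sqrt_minus_1:
  fixes w :: complex
  assumes "w\<^sup>2 = -1"
  shows "\<exists>N::int. poly (hermite_neg k (of_nat d)) w = w ^ k * of_int (1 + int d * N)"
proof (induction k rule: induct_nat_012)
  case 0
  show ?case by (rule exI[of _ 0]) simp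
next
  case 1
  show ?case by (rule exI[of _ 0]) (simp add: poly_monom)
next
  case (ge2 k)
  then obtain M N where
    M: "poly (hermite_neg k (of_nat d)) w = w ^ k * of_int (1 + int d * M)" and
    N: "poly (hermite_neg (Suc k) (of_nat d)) w = w ^ Suc k * of_int (1 + int d * N)"
    by blast
  have w: "w ^ k = - (w ^ Suc (Suc k))"
    using assms by (simp add: power2_eq_square flip: mult.assoc)
  have "poly (hermite_neg (Suc (Suc k)) (of_nat d)) w =
      w ^ Suc (Suc k) * of_int (1 + int d * N) +
      of_nat d * of_nat (Suc k) * (- (w ^ Suc (Suc k))) * of_int (1 + int d * M)"
    unfolding poly_hermite_neg_rec M N w[symmetric] by (simp only: power_Suc mult_ac)
  also have "\<dots> = w ^ Suc (Suc k) * of_int (1 + int d * (N - int (Suc k) * (1 + int d * M)))"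
  proof -
    have "W * (1 + c * a) + c * l * (- W) * (1 + c * b) = W * (1 + c * (a - l * (1 + c * b)))"
      for W a b c l :: complex
      by (simp add: algebra_simps)
    then show ?thesis
      by (simp only: of_int_add of_int_mult of_int_diff of_int_of_nat_eq of_int_1)
  qed
  finally show ?case by blast
qed

lemma hermite_neg_zero_sqrt_minus_1:
  fixes w :: complex
  assumes "poly (hermite_neg k (of_nat d)) w = 0" and "w\<^sup>2 = -1"
  shows "d = 1"
proof -
  obtain N where "poly (hermite_neg k (of_nat d)) w = w ^ k * of_int (1 + int d * N)"
    using poly_hermite_neg_sqrt_minus_1[OF assms(2)] by blast
  moreover have "w \<noteq> 0" using assms(2) by auto
  ultimately have "(of_int (1 + int d * N) :: complex) = 0"
    using assms(1) by simp
  then have "1 + int d * N = 0" by (simp only: of_int_eq_0_iff)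
  then have "int d dvd 1" by (metis add.commute add_eq_0_iff dvd_minus_iff dvd_triv_left minus_minus)
  then show ?thesis by simp
qed

text \<open>The arithmetic heart of the proof: a factor from an odd size and a factor from an even size
  share no zero, except that the size 1 may contribute the zeros \<open>\<i>\<close> and \<open>-\<i>\<close>.

  Let \<open>y = 1 - z\<^sup>e\<close>.  Both \<open>z\<^sup>d\<close> and \<open>y\<close> are purely imaginary, so a suitable power of \<open>z\<close> shows
  that \<open>(1 - y)\<^sup>d\<close> is real, that is, \<open>(1 + y)\<^sup>d = (1 - y)\<^sup>d\<close>.  If \<open>y\<close> is not 0, this makes \<open>y\<^sup>2\<close> a zero of the
  odd part of \<open>(1 + y)\<^sup>d\<close>, whose constant term \<open>d\<close> is odd; but \<open>y\<^sup>2\<close> is also a zero of a monic polynomial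
  that is a pure power modulo 2, because \<open>e\<close> is even.  Hence \<open>y = 0\<close>, the number \<open>z\<close> lies on the unit
  circle, and \<open>z\<^sup>d\<close> is \<open>\<i>\<close> or \<open>-\<i>\<close>; modulo \<open>d\<close> this is no Hermite zero unless \<open>d = 1\<close>.\<close>

lemma common_zero:
  fixes z :: complex
  assumes "odd d" and "even e" and "e > 0"
    and odd_zero: "poly (hermite_neg k (of_nat d)) (z ^ d) = 0"
    and even_zero: "poly (hermite_neg m (of_nat e)) (1 - z ^ e) = 0"
  shows "d = 1 \<and> z\<^sup>2 = -1"
proof -
  define y where "y = 1 - z ^ e"
  obtain n where e: "e = 2 * n" using assms(2) by blast
  have Re_zd: "Re (z ^ d) = 0"
    using hermite_neg_zero_imaginary[OF odd_zero] assms(1) by (cases d) auto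
  have Re_y: "Re y = 0"
    using hermite_neg_zero_imaginary[OF even_zero] assms(3) by (simp add: y_def)
  \<comment> \<open>The number \<open>((z ^ d)\<^sup>2) ^ n = (z ^ e) ^ d\<close> is real because the left base is.\<close>
  have "(z ^ d)\<^sup>2 \<in> \<real>"
    using Re_zd by (simp add: complex_is_Real_iff power2_eq_square)
  then have "((z ^ d)\<^sup>2) ^ n \<in> \<real>" by (rule Reals_power)
  also have "((z ^ d)\<^sup>2) ^ n = (1 - y) ^ d"
    by (simp add: y_def e mult_ac flip: power_mult)
  finally have "cnj ((1 - y) ^ d) = (1 - y) ^ d" by (simp add: Reals_cnj_iff)
  moreover have "cnj (1 - y) = 1 + y"
    using Re_y by (simp add: complex_eq_iff)
  ultimately have "(1 + y) ^ d = (1 - y) ^ d"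
    by (simp only: complex_cnj_power)
  then have sym: "(1 + y) ^ d = (1 + (- y)) ^ d"
    by simp
  \<comment> \<open>Two integer polynomials vanish at \<open>y\<^sup>2\<close>, and they are coprime modulo 2.\<close>
  have "y = 0"
  proof (rule ccontr)
    assume y: "y \<noteq> 0"
    obtain S T where ST: "coeff S 0 = int d"
      "\<And>y. (1 + y) ^ d = poly (cpoly T) (y\<^sup>2) + y * poly (cpoly S) (y\<^sup>2)"
      using odd_part_of_binomial_power[of d] by blast
    obtain G where G: "lead_coeff G = 1" "\<And>i. i < degree G \<Longrightarrow> even (coeff G i)"
      "\<And>y. poly (hermite_neg m (of_nat e)) y = y ^ (m mod 2) * poly (cpoly G) (y\<^sup>2)"
      using hermite_neg_in_square[OF assms(2), of m] by blast
    have "poly (cpoly S) (y\<^sup>2) = 0"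
      using sym y unfolding ST(2) by simp
    moreover have "poly (cpoly G) (y\<^sup>2) = 0"
      using even_zero y unfolding y_def[symmetric] G(3) by simp
    ultimately show False
      using no_common_root_mod_2[of S "y\<^sup>2" G] ST(1) G(1,2) assms(1) by simp
  qed
  then have "z ^ e = 1" by (simp add: y_def)
  then have "norm z ^ e = 1" by (metis norm_one norm_power)
  then have "norm z = 1" using assms(3) power_eq_imp_eq_base[of "norm z" e 1] by simp
  then have "norm (z ^ d) = 1" by (simp add: norm_power)
  then have "(z ^ d)\<^sup>2 = -1"
    using Re_zd abs_mult_self_eq[of "Im (z ^ d)"]
    by (simp add: complex_eq_iff cmod_def power2_eq_square)
  with hermite_neg_zero_sqrt_minus_1[OF odd_zero] have "d = 1" by simp
  with \<open>(z ^ d)\<^sup>2 = -1\<close> show ?thesis by simp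
qed

text \<open>For the size 1 the zeros \<open>\<i>\<close> and \<open>-\<i>\<close> occur together and are simple, so \<open>x\<^sup>2 + 1\<close> can be split off,
  and after at most one such step it is gone completely.\<close>

lemma hermite_neg_split_off_x2_plus_1:
  obtains \<epsilon> :: nat and Q :: "complex poly"
  where "\<epsilon> \<le> 1" "hermite_neg k 1 = [:1, 0, 1:] ^ \<epsilon> * Q" "\<And>z. z\<^sup>2 = -1 \<Longrightarrow> poly Q z \<noteq> 0"
proof -
  let ?H = "hermite_neg k 1 :: complex poly"
  have sq: "z\<^sup>2 = -1 \<longleftrightarrow> z = \<i> \<or> z = - \<i>" for z :: complex
    using power2_eq_iff[of z \<i>] by simp
  show ?thesis
  proof (cases "poly ?H \<i> = 0")
    case False
    then have "poly ?H (- \<i>) \<noteq> 0" by (simp add: poly_hermite_neg_minus)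
    with False show ?thesis by (intro that[of 0 ?H]) (auto simp: sq)
  next
    case True
    then have minus: "poly ?H (- \<i>) = 0" by (simp add: poly_hermite_neg_minus)
    obtain Q1 where Q1: "?H = [:- \<i>, 1:] * Q1"
      using True by (auto simp: poly_eq_0_iff_dvd elim: dvdE)
    with minus have "poly Q1 (- \<i>) = 0" by simp
    then obtain Q where Q: "Q1 = [:\<i>, 1:] * Q"
      by (auto simp: poly_eq_0_iff_dvd elim: dvdE)
    have eq: "?H = [:1, 0, 1:] * Q"
      unfolding Q1 Q mult.assoc[symmetric] by simp
    have k: "k \<noteq> 0" using True by (intro notI) simp
    then obtain l where l: "k = Suc l" by (cases k) auto
    have "poly Q z \<noteq> 0" if z: "z\<^sup>2 = -1" for z
    proof
      assume "poly Q z = 0"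
      have "poly (pderiv ?H) z = 0"
      proof -
        have "poly (pderiv ([:1, 0, 1:] * Q)) z =
            (1 + z * z) * poly (pderiv Q) z + poly Q z * poly (pderiv [:1, 0, 1:]) z"
          unfolding pderiv_mult by (simp add: algebra_simps)
        then show ?thesis
          unfolding eq using z \<open>poly Q z = 0\<close> by (simp only: power2_eq_square) simp
      qed
      then have "poly (hermite_neg l 1) z = 0"
        unfolding l pderiv_hermite_neg by (simp del: of_nat_Suc)
      moreover have "poly (hermite_neg (Suc l) 1) z = 0"
        unfolding l[symmetric] eq using \<open>poly Q z = 0\<close> by simp
      ultimately show False
        using hermite_neg_no_consecutive_zeros[of 1 l z] by simp
    qed
    with eq show ?thesis by (intro that[of 1 Q]) auto
  qed
qed

section \<open>The factor contributed by one size\<close>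

text \<open>The factor that \<open>m\<close> parts of size \<open>d\<close> contribute to the partition polynomial.  It is 1 for \<open>m = 0\<close>,
  so that products may range over any finite set containing the parts.\<close>

definition part_factor :: "nat \<Rightarrow> nat \<Rightarrow> int poly" where
  "part_factor m d = pcompose (hermite_neg m (int d)) (if even d then 1 - monom 1 d else monom 1 d)"

lemma degree_1_minus_monom: "degree (1 - monom 1 d :: int poly) = d"
proof (cases "d = 0")
  case False
  show ?thesis
  proof (rule antisym)
    show "degree (1 - monom 1 d :: int poly) \<le> d"
      by (rule degree_le) auto
    show "d \<le> degree (1 - monom 1 d :: int poly)"
      using False by (intro le_degree) simp
  qed
qed simp

lemma part_factor_0 [simp]: "part_factor 0 d = 1"
  by (simp add: part_factor_def pcompose_1)

lemma monom_1_1: "monom 1 (Suc 0) = [:0, 1:]"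
  by (simp add: monom_Suc monom_0)

lemma part_factor_1: "part_factor 1 d = (if even d then 1 - monom 1 d else monom 1 d)"
  by (simp add: part_factor_def monom_1_1 pcompose_pCons)

lemma part_factor_2_1: "part_factor 2 1 = [:1, 0, 1:]"
  using hermite_neg_rec[of 0 "1::int"]
  by (simp add: part_factor_def numeral_2_eq_2 monom_1_1)

lemma degree_part_factor: "degree (part_factor m d) = m * d"
  by (simp add: part_factor_def degree_pcompose degree_1_minus_monom degree_monom_eq)

lemma part_factor_nonzero:
  assumes "d > 0"
  shows "part_factor m d \<noteq> 0"
proof (cases "m = 0")
  case False
  then have "degree (part_factor m d) \<noteq> 0" using assms by (simp add: degree_part_factor)
  then show ?thesis by auto
qed simp

lemma monic_part_factor_odd:
  assumes "odd d"
  shows "lead_coeff (part_factor m d) = 1"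
proof -
  have "d > 0" using assms by (cases d) auto
  then show ?thesis
    using assms by (simp add: part_factor_def lead_coeff_comp degree_monom_eq)
qed

section \<open>Two-term expansions\<close>

text \<open>The congruence \<open>f \<equiv> a + b x\<^sup>n\<close> modulo \<open>x^(n+1)\<close>.\<close>

definition two_terms :: "nat \<Rightarrow> int poly \<Rightarrow> int \<Rightarrow> int \<Rightarrow> bool" where
  "two_terms n f a b \<longleftrightarrow> monom 1 (Suc n) dvd f - (monom a 0 + monom b n)"

lemma two_terms_iff:
  assumes "n > 0"
  shows "two_terms n f a b \<longleftrightarrow> coeff f 0 = a \<and> coeff f n = b \<and> (\<forall>i. 0 < i \<and> i < n \<longrightarrow> coeff f i = 0)"
proof -
  have "coeff (f - (monom a 0 + monom b n)) i =
      coeff f i - ((if i = 0 then a else 0) + (if i = n then b else 0))" for i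
    by simp
  then have *: "two_terms n f a b \<longleftrightarrow>
      (\<forall>i<Suc n. coeff f i = (if i = 0 then a else 0) + (if i = n then b else 0))"
    unfolding two_terms_def monom_1_dvd_iff' by (simp only: right_minus_eq)
  show ?thesis
  proof
    assume "two_terms n f a b"
    with * have "coeff f i = (if i = 0 then a else 0) + (if i = n then b else 0)" if "i < Suc n" for i
      using that by blast
    then show "coeff f 0 = a \<and> coeff f n = b \<and> (\<forall>i. 0 < i \<and> i < n \<longrightarrow> coeff f i = 0)"
      using assms by simp
  next
    assume "coeff f 0 = a \<and> coeff f n = b \<and> (\<forall>i. 0 < i \<and> i < n \<longrightarrow> coeff f i = 0)"
    then show "two_terms n f a b"
      unfolding * using assms by (auto simp: less_Suc_eq)
  qed
qed

lemma two_terms_unique: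
  assumes "n > 0" "two_terms n f a b" "two_terms n f a' b'"
  shows "a = a' \<and> b = b'"
  using assms by (simp add: two_terms_iff)

lemma two_terms_mult:
  assumes "n > 0" "two_terms n f a b" "two_terms n g a' b'"
  shows "two_terms n (f * g) (a * a') (a * b' + a' * b)"
proof -
  obtain r where "f - (monom a 0 + monom b n) = monom 1 (Suc n) * r"
    using assms(2) by (auto simp: two_terms_def elim: dvdE)
  then have f: "f = monom a 0 + monom b n + monom 1 (Suc n) * r"
    by (simp add: algebra_simps)
  obtain s where "g - (monom a' 0 + monom b' n) = monom 1 (Suc n) * s"
    using assms(3) by (auto simp: two_terms_def elim: dvdE)
  then have g: "g = monom a' 0 + monom b' n + monom 1 (Suc n) * s"
    by (simp add: algebra_simps)
  \<comment> \<open>The exponent \<open>2 n\<close> exceeds \<open>n\<close> because \<open>n > 0\<close>.\<close>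
  have sq: "monom b n * monom b' n = monom 1 (Suc n) * monom (b * b') (n - 1)"
    using assms(1) by (simp add: mult_monom)
  have lin: "monom (a * a') 0 + monom (a * b' + a' * b) n =
      monom a 0 * monom a' 0 + monom a 0 * monom b' n + monom a' 0 * monom b n"
    by (simp add: mult_monom add_monom[symmetric])
  have "f * g - (monom (a * a') 0 + monom (a * b' + a' * b) n) = monom b n * monom b' n +
      monom 1 (Suc n) * (r * g + (monom a 0 + monom b n) * s)"
    unfolding lin f g by (simp only: algebra_simps)
  also have "\<dots> = monom 1 (Suc n) * (monom (b * b') (n - 1) + (r * g + (monom a 0 + monom b n) * s))"
    unfolding sq by (simp only: algebra_simps)
  finally show ?thesis unfolding two_terms_def by simp
qed

lemma two_terms_prod:
  assumes "n > 0" "\<And>x. x \<in> A \<Longrightarrow> two_terms n (f x) (a x) 0"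
  shows "two_terms n (prod f A) (prod a A) 0"
  using assms(2)
proof (induction A rule: infinite_finite_induct)
  case (insert x A)
  then show ?case
    using two_terms_mult[OF assms(1), of "f x" "a x" 0 "prod f A" "prod a A" 0] by simp
qed (use assms(1) in \<open>simp_all add: two_terms_iff\<close>)

lemma two_terms_truncate:
  assumes "0 < k" "k < n" "two_terms n f a b"
  shows "two_terms k f a 0"
  using assms by (simp add: two_terms_iff)

text \<open>If \<open>f\<close> is congruent to \<open>a (1 + u x^n)\<close>, then \<open>u\<close> is the coefficient of \<open>x^n\<close> in the logarithm of \<open>f / a\<close>.  It is
  additive in \<open>f\<close>, and the constant \<open>a\<close>, which varies from factor to factor, is quantified away.\<close>

definition log_coeff :: "nat \<Rightarrow> int poly \<Rightarrow> int \<Rightarrow> bool" where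
  "log_coeff n f u \<longleftrightarrow> (\<exists>a. a \<noteq> 0 \<and> two_terms n f a (a * u))"

lemma log_coeff_unique:
  assumes "n > 0" "log_coeff n f u" "log_coeff n f w"
  shows "u = w"
proof -
  obtain a b where "a \<noteq> 0" "two_terms n f a (a * u)" "two_terms n f b (b * w)"
    using assms(2,3) unfolding log_coeff_def by blast
  with two_terms_unique[OF assms(1)] show ?thesis by force
qed

lemma log_coeff_mult:
  assumes "n > 0" "log_coeff n f u" "log_coeff n g w"
  shows "log_coeff n (f * g) (u + w)"
proof -
  obtain a where a: "a \<noteq> 0" "two_terms n f a (a * u)"
    using assms(2) by (auto simp: log_coeff_def)
  obtain b where b: "b \<noteq> 0" "two_terms n g b (b * w)"
    using assms(3) by (auto simp: log_coeff_def)
  have "a * (b * w) + b * (a * u) = a * b * (u + w)" by (simp add: algebra_simps)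
  with two_terms_mult[OF assms(1) a(2) b(2)] a(1) b(1) show ?thesis
    unfolding log_coeff_def by (intro exI[of _ "a * b"]) simp
qed

lemma log_coeff_1: "n > 0 \<Longrightarrow> log_coeff n 1 0"
  unfolding log_coeff_def by (rule exI[of _ 1]) (simp add: two_terms_iff)

lemma log_coeff_prod:
  assumes "n > 0" "\<And>x. x \<in> A \<Longrightarrow> log_coeff n (f x) (u x)"
  shows "log_coeff n (prod f A) (sum u A)"
  using assms(2)
  by (induction A rule: infinite_finite_induct)
     (simp_all add: log_coeff_1 log_coeff_mult assms(1))

lemma log_coeff_truncate:
  assumes "0 < k" "k < n" "log_coeff n f u"
  shows "log_coeff k f 0"
proof -
  obtain a where "a \<noteq> 0" "two_terms n f a (a * u)"
    using assms(3) unfolding log_coeff_def by blast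
  with two_terms_truncate[OF assms(1,2)] show ?thesis
    unfolding log_coeff_def by (intro exI[of _ a]) simp
qed

lemma log_coeff_prod_first:
  assumes "finite A" "x \<in> A" "n > 0" "log_coeff n (f x) u"
    and "\<And>y. y \<in> A \<Longrightarrow> y \<noteq> x \<Longrightarrow> log_coeff n (f y) 0"
  shows "log_coeff n (prod f A) u"
proof -
  have "log_coeff n (prod f A) (\<Sum>y\<in>A. if y = x then u else 0)"
    using assms(3-5) by (intro log_coeff_prod) auto
  then show ?thesis using assms(1,2) by simp
qed

text \<open>If the factor of index \<open>d\<close> starts with a constant and continues at exponent \<open>c d\<close>, then a
  product of such factors is triangular: its lowest nonconstant coefficient sees only the smallest index.
  After cancelling the factors that agree, the smallest index at which the factors
  differ would be visible in the product.\<close>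

lemma log_coeff_prod_determined:
  fixes f g :: "nat \<Rightarrow> int poly"
  assumes "finite S" and "c > 0" and pos: "\<And>d. d \<in> S \<Longrightarrow> d > 0"
    and eq: "prod f S = prod g S"
    and nz: "\<And>d. d \<in> S \<Longrightarrow> f d \<noteq> 0"
    and f: "\<And>d. d \<in> S \<Longrightarrow> log_coeff (c * d) (f d) (u d)"
    and g: "\<And>d. d \<in> S \<Longrightarrow> log_coeff (c * d) (g d) (w d)"
    and cancel: "\<And>d. d \<in> S \<Longrightarrow> u d = w d \<Longrightarrow> f d = g d"
    and "d \<in> S"
  shows "u d = w d"
proof (rule ccontr)
  assume "u d \<noteq> w d"
  define T where "T = {d \<in> S. u d \<noteq> w d}"
  have T: "finite T" "T \<noteq> {}" "T \<subseteq> S"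
    using assms(1,9) \<open>u d \<noteq> w d\<close> by (auto simp: T_def)
  define D where "D = Min T"
  have D: "D \<in> T" "\<And>e. e \<in> T \<Longrightarrow> D \<le> e"
    using T by (simp_all add: D_def)
  have "D \<in> S" using D(1) T(3) by blast
  have "prod f (S - T) = prod g (S - T)"
    by (rule prod.cong) (auto simp: T_def cancel)
  moreover have "prod f (S - T) \<noteq> 0"
    using assms(1) nz by simp
  ultimately have eqT: "prod f T = prod g T"
    using eq prod.subset_diff[OF T(3) assms(1), of f] prod.subset_diff[OF T(3) assms(1), of g]
    by simp
  have cD: "c * D > 0" using assms(2) pos[OF \<open>D \<in> S\<close>] by simp
  have small: "c * D < c * e" if "e \<in> T" "e \<noteq> D" for e
    using D(2)[OF that(1)] that(2) assms(2) by simp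
  have "log_coeff (c * D) (prod f T) (u D)"
    using T D(1) cD \<open>D \<in> S\<close>
    by (intro log_coeff_prod_first[where x = D] f) (auto intro!: log_coeff_truncate[OF cD small f])
  moreover have "log_coeff (c * D) (prod g T) (w D)"
    using T D(1) cD \<open>D \<in> S\<close>
    by (intro log_coeff_prod_first[where x = D] g) (auto intro!: log_coeff_truncate[OF cD small g])
  ultimately have "u D = w D"
    using log_coeff_unique[OF cD] eqT by simp
  with D(1) show False by (simp add: T_def)
qed

section \<open>Multiplicities from the leading terms\<close>

lemma two_terms_power_minus_1:
  assumes "d > 0"
  shows "two_terms d ((monom 1 d - 1) ^ m) ((-1) ^ m) ((-1) ^ m * - int m)"
proof (induction m)
  case 0
  show ?case using assms by (simp add: two_terms_iff)
next
  case (Suc m)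
  have "two_terms d (monom 1 d - 1) (-1) 1"
    using assms by (simp add: two_terms_iff)
  from two_terms_mult[OF assms this Suc] show ?case
    by (simp add: algebra_simps)
qed

lemma reflect_1_minus_monom:
  assumes "d > 0"
  shows "reflect_poly (1 - monom 1 d :: int poly) = monom 1 d - 1"
  using assms by (intro poly_eqI) (auto simp: coeff_reflect_poly degree_1_minus_monom)

text \<open>Reflecting a polynomial turns its leading terms into its lowest ones.  The leading part of
  the factor of an even size is \<open>(1 - x^d)^m\<close>, since the remaining Hermite terms drop the degree by at least \<open>2 d\<close>.
  So the multiplicity itself can be read off.\<close>

lemma log_coeff_reflect_even:
  assumes "even d" "d > 0"
  shows "log_coeff d (reflect_poly (part_factor m d)) (- int m)"
proof (cases "m = 0")
  case True
  then show ?thesis using assms by (simp add: log_coeff_1)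
next
  case False
  define y :: "int poly" where "y = 1 - monom 1 d"
  have degy: "degree y = d" by (simp add: y_def degree_1_minus_monom)
  then have y: "y \<noteq> 0" using assms(2) by auto
  define g where "g = hermite_neg m (int d) - monom 1 m"
  have pc: "pcompose (monom 1 m) y = y ^ m"
    by (induction m) (simp_all add: monom_0 monom_Suc pcompose_pCons pcompose_1 flip: one_pCons)
  have split: "part_factor m d = y ^ m + pcompose g y"
    using assms(1) by (simp add: part_factor_def g_def y_def[symmetric] pcompose_diff pc)
  have coeff: "coeff (part_factor m d) (m * d - i) = coeff (y ^ m) (m * d - i)" if "i \<le> d" for i
  proof (cases "g = 0")
    case True
    then show ?thesis by (simp add: split)
  next
    case g: False
    have "coeff g j = 0" if "j > m - 2" for j
      using that by (cases "j = m \<or> j = m - 1") (auto simp: g_def coeff_hermite_neg odd_double_fact_def)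
    then have "degree g \<le> m - 2" by (intro degree_le) simp
    have "m \<ge> 2"
    proof (rule ccontr)
      assume "\<not> m \<ge> 2"
      with False have "m = 1" by simp
      then have "g = 0" by (simp add: g_def)
      with g show False by simp
    qed
    have "degree (pcompose g y) \<le> (m - 2) * d"
      using \<open>degree g \<le> m - 2\<close> by (simp add: degree_pcompose degy)
    also have "\<dots> < m * d - i"
    proof -
      have "m * d = (m - 2) * d + 2 * d"
        using \<open>m \<ge> 2\<close> by (metis add_mult_distrib le_add_diff_inverse2)
      then show ?thesis using that assms(2) by linarith
    qed
    finally show ?thesis by (simp add: split coeff_eq_0)
  qed
  have dm: "d \<le> m * d" using False by simp
  have deg_ym: "degree (y ^ m) = m * d"
    using y by (simp add: degree_power_eq degy)
  have "coeff (reflect_poly (part_factor m d)) i = coeff (reflect_poly (y ^ m)) i" if "i \<le> d" for i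
    using that dm coeff[OF that]
    by (simp add: coeff_reflect_poly degree_part_factor deg_ym)
  moreover have "reflect_poly (y ^ m) = (monom 1 d - 1) ^ m"
    unfolding reflect_poly_power y_def by (simp add: reflect_1_minus_monom assms(2))
  ultimately have "two_terms d (reflect_poly (part_factor m d)) ((-1) ^ m) ((-1) ^ m * - int m)"
    using two_terms_power_minus_1[OF assms(2), of m] assms(2)
    by (simp add: two_terms_iff del: coeff_0_reflect_poly)
  then show ?thesis
    unfolding log_coeff_def by (intro exI[of _ "(-1) ^ m"]) simp
qed

lemma coeff_pcompose_monom:
  fixes p :: "'a::comm_semiring_1 poly"
  assumes "d > 0"
  shows "coeff (pcompose p (monom 1 d)) i = (if d dvd i then coeff p (i div d) else 0)"
proof (induction p arbitrary: i)
  case (pCons a p)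
  have *: "coeff (monom 1 d * q) i = (if i < d then 0 else coeff q (i - d))" for q :: "'a poly"
    by (simp add: coeff_monom_mult not_less)
  show ?case
  proof (cases "i < d")
    case True
    then show ?thesis
      using assms by (auto simp: pcompose_pCons * dvd_imp_le coeff_pCons split: nat.splits)
  next
    case False
    then have "i div d = Suc ((i - d) div d)" "d dvd i - d \<longleftrightarrow> d dvd i" "i > 0"
      using assms by (simp_all add: le_div_geq dvd_minus_self)
    with False show ?thesis
      by (simp add: pcompose_pCons * pCons.IH) (simp add: coeff_pCons split: nat.splits)
  qed
qed simp

lemma coeff_part_factor_odd:
  assumes "odd d"
  shows "coeff (part_factor k d) i = (if d dvd i then coeff (hermite_neg k (int d)) (i div d) else 0)"
proof -
  have "d > 0" using assms by (cases d) auto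
  then show ?thesis using assms by (simp add: part_factor_def coeff_pcompose_monom)
qed

lemma reflect_part_factor_odd_1:
  assumes "odd d"
  shows "reflect_poly (part_factor 1 d) = 1"
  unfolding part_factor_1 using assms
  by (intro poly_eqI) (auto simp: coeff_reflect_poly degree_monom_eq)

text \<open>For an odd size the two leading terms of the Hermite polynomial \<open>y^k + d (k choose 2) y^(k-2) + \<dots>\<close> are
  \<open>2 d\<close> apart in \<open>x\<close>.  This sees \<open>k choose 2\<close>, which does not tell the multiplicities 0 and 1 apart.\<close>

lemma log_coeff_reflect_odd:
  assumes "odd d"
  shows "log_coeff (2 * d) (reflect_poly (part_factor k d)) (int d * int (k choose 2))"
proof -
  have d: "d > 0" using assms by (cases d) auto
  consider "k = 0" | "k = 1" | "k \<ge> 2" by linarith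
  then show ?thesis
  proof cases
    case 1
    then show ?thesis using d by (simp add: log_coeff_1 binomial_eq_0)
  next
    case 2
    then show ?thesis
      using d reflect_part_factor_odd_1[OF assms] by (simp add: log_coeff_1 binomial_eq_0)
  next
    case 3
    then have kd: "2 * d \<le> k * d" by simp
    have R: "coeff (reflect_poly (part_factor k d)) i = coeff (part_factor k d) (k * d - i)"
      if "i \<le> 2 * d" for i
      using order_trans[OF that kd] by (simp add: coeff_reflect_poly degree_part_factor not_less)
    have c0: "coeff (part_factor k d) (k * d) = 1"
      using d by (simp add: coeff_part_factor_odd[OF assms])
    have "k * d - 2 * d = (k - 2) * d" by (simp add: diff_mult_distrib)
    then have c2: "coeff (part_factor k d) (k * d - 2 * d) = int d * int (k choose 2)"
      using d 3 by (simp add: coeff_part_factor_odd[OF assms] coeff_hermite_neg odd_double_fact_def)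
    have c1: "coeff (part_factor k d) (k * d - i) = 0" if i: "0 < i" "i < 2 * d" for i
    proof (cases "d dvd k * d - i")
      case True
      have "k * d - (k * d - i) = i" by (rule diff_diff_cancel) (use i kd in linarith)
      then have "d dvd i" using True by (metis dvd_diff_nat dvd_triv_right)
      then obtain q where q: "i = d * q" by blast
      with i have "q = 1" by (cases q) auto
      then have "k * d - i = (k - 1) * d" using q by (simp add: diff_mult_distrib)
      then show ?thesis
        using d 3 by (simp add: coeff_part_factor_odd[OF assms] coeff_hermite_neg)
    qed (simp add: coeff_part_factor_odd[OF assms])
    have "two_terms (2 * d) (reflect_poly (part_factor k d)) 1 (int d * int (k choose 2))"
      using d c0 c1 c2 by (simp add: two_terms_iff R del: coeff_0_reflect_poly)
    then show ?thesis
      unfolding log_coeff_def by (intro exI[of _ 1]) simp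
  qed
qed

text \<open>The triangular numbers \<open>0, 0, 1, 3, 6, \<dots>\<close> have a gap of 1 only at the start.\<close>

lemma choose_two_eq_Suc:
  assumes "k choose 2 = Suc (l choose 2)"
  shows "k = 2 \<and> l \<le> 1"
proof -
  have l: "l \<le> 1"
  proof (rule ccontr)
    assume "\<not> l \<le> 1"
    have "k > l"
    proof (rule ccontr)
      assume "\<not> k > l"
      then have "k choose 2 \<le> l choose 2" by (simp add: binomial_right_mono)
      with assms show False by simp
    qed
    then have "Suc l choose 2 \<le> k choose 2" by (simp add: binomial_right_mono)
    moreover have "Suc l choose 2 = l + (l choose 2)" by (simp add: numeral_2_eq_2)
    ultimately show False using assms \<open>\<not> l \<le> 1\<close> by simp
  qed
  then have "l choose 2 = 0" by (simp add: binomial_eq_0)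
  then have k1: "k choose 2 = 1" using assms by simp
  have "k = 2"
  proof (rule ccontr)
    assume "k \<noteq> 2"
    then consider "k < 2" | "k \<ge> 3" by linarith
    then show False
    proof cases
      case 2
      then have "3 choose 2 \<le> k choose 2" by (rule binomial_right_mono)
      with k1 show False by (simp add: numeral_3_eq_3 numeral_2_eq_2)
    qed (use k1 in \<open>simp add: binomial_eq_0\<close>)
  qed
  with l show ?thesis by simp
qed

lemma choose_two_inj:
  assumes "k choose 2 = l choose 2"
  shows "k = l \<or> (k \<le> 1 \<and> l \<le> 1)"
proof -
  have "b \<le> 1" if "a choose 2 = b choose 2" "a < b" for a b :: nat
  proof (rule ccontr)
    assume "\<not> b \<le> 1"
    have "Suc a choose 2 \<le> b choose 2" using that(2) by (simp add: binomial_right_mono)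
    moreover have "Suc a choose 2 = a + (a choose 2)" by (simp add: numeral_2_eq_2)
    ultimately have "a = 0" using that(1) by simp
    then have "b choose 2 = 0" using that(1) by (simp add: binomial_eq_0)
    with \<open>\<not> b \<le> 1\<close> show False by (simp add: binomial_eq_0_iff)
  qed
  from this[of k l] this[of l k] assms show ?thesis
    by (metis le_trans less_imp_le linorder_neqE_nat)
qed

lemma even_multiplicities_determined:
  assumes "finite S" and S: "\<And>d. d \<in> S \<Longrightarrow> even d \<and> d > 0"
    and "(\<Prod>d\<in>S. part_factor (M d) d) = (\<Prod>d\<in>S. part_factor (N d) d)"
    and "d \<in> S"
  shows "M d = N d"
proof -
  have "- int (M d) = - int (N d)"
  proof (rule log_coeff_prod_determined[where c = 1 and S = S
        and u = "\<lambda>d. - int (M d)" and w = "\<lambda>d. - int (N d)" and f = "\<lambda>d. reflect_poly (part_factor (M d) d)" and g = "\<lambda>d. reflect_poly (part_factor (N d) d)"])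
    show "(\<Prod>d\<in>S. reflect_poly (part_factor (M d) d)) = (\<Prod>d\<in>S. reflect_poly (part_factor (N d) d))"
      using assms(3) by (simp flip: reflect_poly_prod)
  qed (use assms log_coeff_reflect_even part_factor_nonzero in auto)
  then show ?thesis by simp
qed

text \<open>Reflection discards powers of \<open>x\<close>, so a single part of odd size leaves no trace in the reflected product.\<close>

lemma odd_multiplicities_determined:
  assumes "finite S" and S: "\<And>d. d \<in> S \<Longrightarrow> odd d"
    and eq: "reflect_poly (\<Prod>d\<in>S. part_factor (M d) d) = reflect_poly (\<Prod>d\<in>S. part_factor (N d) d)"
    and "d \<in> S"
  shows "M d = N d \<or> (M d \<le> 1 \<and> N d \<le> 1)"
proof -
  have pos: "d > 0" if "d \<in> S" for d using S[OF that] by (cases d) auto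
  have simple: "reflect_poly (part_factor k d) = 1" if "k \<le> 1" "odd d" for k d
    using that reflect_part_factor_odd_1[of d] by (cases k) auto
  have "int d * int (M d choose 2) = int d * int (N d choose 2)"
  proof (rule log_coeff_prod_determined[where c = 2 and S = S
        and u = "\<lambda>d. int d * int (M d choose 2)" and w = "\<lambda>d. int d * int (N d choose 2)" and f = "\<lambda>d. reflect_poly (part_factor (M d) d)" and g = "\<lambda>d. reflect_poly (part_factor (N d) d)"])
    show "(\<Prod>d\<in>S. reflect_poly (part_factor (M d) d)) = (\<Prod>d\<in>S. reflect_poly (part_factor (N d) d))"
      using eq by (simp only: reflect_poly_prod)
    show "reflect_poly (part_factor (M d) d) = reflect_poly (part_factor (N d) d)"
      if "d \<in> S" "int d * int (M d choose 2) = int d * int (N d choose 2)" for d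
    proof -
      have "M d choose 2 = N d choose 2" using that(2) pos[OF that(1)] by simp
      then consider "M d = N d" | "M d \<le> 1" "N d \<le> 1" using choose_two_inj by blast
      then show ?thesis by cases (use simple S[OF that(1)] in auto)
    qed
  qed (use assms pos log_coeff_reflect_odd part_factor_nonzero in auto)
  then have "M d choose 2 = N d choose 2" using pos[OF assms(4)] by simp
  then show ?thesis by (rule choose_two_inj)
qed

section \<open>Hermite values at 1 and the lowest terms\<close>

text \<open>The subtraction \<open>m - 1\<close> is harmless for \<open>m = 0\<close>, where its term has coefficient 0.\<close>

lemma hermite_value_rec:
  "poly (hermite_neg (Suc m) v) 1 = poly (hermite_neg m v) 1 + v * of_nat m * poly (hermite_neg (m - 1) v) 1"
  for v :: "'a::comm_ring_1"
  by (cases m) (simp_all add: poly_hermite_neg_rec poly_monom)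

lemma odd_hermite_value:
  assumes "even v"
  shows "odd (poly (hermite_neg m v) (1::int))"
  by (induction m) (use assms in \<open>simp_all add: hermite_value_rec\<close>)

text \<open>Here \<open>h m\<close> is the value of the \<open>m\<close>-th Hermite polynomial at 1.  Put \<open>R m = m h(m-1) / h(m)\<close>; the equation says \<open>R (m+1) = R m + 1\<close>.
  Together with the recurrence it turns, for \<open>m > 0\<close>, into \<open>R (m+1) = R (m-1)\<close>.  This is
  impossible modulo 4: the recurrence with even \<open>D\<close> gives \<open>R m \<equiv> m\<close> there.  The proof clears denominators.\<close>

lemma hermite_value_ratio:
  fixes h :: "nat \<Rightarrow> int"
  assumes rec: "\<And>m. h (Suc m) = h m + D * int m * h (m - 1)" and odd: "\<And>m. odd (h m)"
    and "even D" "D \<noteq> 0"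
    and eq: "(h m + int m * h (m - 1)) * h (Suc m) = (int m + 1) * (h m)\<^sup>2"
  shows "m = 0"
proof (rule ccontr)
  assume "m \<noteq> 0"
  then obtain n where m: "m = Suc n" by (cases m) auto
  define a b c where "a = h (Suc n)" and "b = h n" and "c = h (n - 1)"
  have a: "a = b + D * int n * c" using rec[of n] by (simp add: a_def b_def c_def)
  have par: "odd a" "odd b" "odd c" using odd by (simp_all add: a_def b_def c_def)
  \<comment> \<open>The trivial solution is divided out in the form of the factor \<open>n + 1\<close>, then the factor \<open>D\<close>.\<close>
  have "(a + (int n + 1) * b) * (a + D * (int n + 1) * b) = (int n + 2) * a\<^sup>2"
    using eq rec[of "Suc n"] by (simp add: m a_def b_def add_ac)
  then have "(int n + 1) * ((D + 1) * a * b + D * (int n + 1) * b\<^sup>2 - a\<^sup>2) = 0"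
    by (simp add: algebra_simps power2_eq_square)
  then have "(D + 1) * a * b + D * (int n + 1) * b\<^sup>2 - a * a = 0"
    by (simp add: power2_eq_square)
  then have "(D + 1) * a * b + D * (int n + 1) * b\<^sup>2 - a * (b + D * int n * c) = 0"
    by (subst (asm) (3) a)
  then have "D * (b * (a + (int n + 1) * b) - int n * c * a) = 0"
    by (simp add: algebra_simps power2_eq_square)
  then have key: "b * (a + (int n + 1) * b) = int n * c * a"
    using assms(4) by simp
  \<comment> \<open>The two sides of \<open>key\<close> are incongruent modulo 4; in either case half of their difference is odd.\<close>
  obtain D' where D': "D = 2 * D'" using assms(3) by blast
  show False
  proof (cases "even n")
    case True
    then obtain j where j: "n = 2 * j" by blast
    have "2 * (b * b + 2 * (D' * int j * c * b) + int j * (b * b - c * a)) = 0"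
      using key unfolding j D' by (subst (asm) (1) a) (simp add: j D' algebra_simps)
    then have "b * b + 2 * (D' * int j * c * b) + int j * (b * b - c * a) = 0" by simp
    moreover have "odd (b * b + 2 * (D' * int j * c * b) + int j * (b * b - c * a))"
      using par by simp
    ultimately show False by simp
  next
    case False
    then obtain j where j: "n = 2 * j + 1" by (elim oddE)
    define e where "e = h (n - 2)"
    have b: "b = c + 4 * (D' * int j * e)"
      using rec[of "2 * j"] by (simp add: b_def c_def e_def j D')
    have "b * (a + (int n + 1) * b) - int n * c * a =
        (b - c) * a + 2 * ((int j + 1) * b * b - int j * c * a)"
      by (simp add: j algebra_simps)
    also have "\<dots> = 2 * (2 * (D' * int j * e * a) + b * b + int j * (b * b - c * a))"
      by (subst (1) b) (simp add: algebra_simps)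
    finally have "2 * (D' * int j * e * a) + b * b + int j * (b * b - c * a) = 0"
      using key by simp
    moreover have "odd (2 * (D' * int j * e * a) + b * b + int j * (b * b - c * a))"
      using par by simp
    ultimately show False by simp
  qed
qed

text \<open>The Taylor expansion at 1, with the derivative of the Hermite polynomial expressed by its predecessor.\<close>

lemma two_terms_part_factor_even:
  assumes "even d" "d > 0"
  shows "two_terms d (part_factor m d) (poly (hermite_neg m (int d)) 1)
    (- int m * poly (hermite_neg (m - 1) (int d)) 1)"
proof -
  have gen: "two_terms d (pcompose f (1 - monom 1 d)) (poly f 1) (- poly (pderiv f) 1)" for f :: "int poly"
  proof (induction f)
    case 0
    show ?case using assms by (simp add: two_terms_iff)
  next
    case (pCons a f)
    have "two_terms d (1 - monom 1 d) 1 (-1)"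
      using assms(2) by (simp add: two_terms_iff)
    from two_terms_mult[OF assms(2) this pCons.IH] show ?case
      using assms(2) by (simp add: two_terms_iff pcompose_pCons pderiv_pCons coeff_pCons split: nat.splits)
  qed
  show ?thesis
    using gen[of "hermite_neg m (int d)"] assms
    by (cases m) (simp_all add: part_factor_def pderiv_hermite_neg algebra_simps)
qed

lemma two_terms_monom: "n > 0 \<Longrightarrow> two_terms n (1 - monom 1 n) 1 (-1)"
  by (simp add: two_terms_iff)

text \<open>Let products over even sizes, all at least \<open>D\<close>, be related by a factor \<open>1 - x^D\<close>, up to a \<open>g\<close> that is
  invisible at exponent \<open>D\<close> from both ends.  From the leading terms, the multiplicities of \<open>D\<close> differ by 1.  From
  the lowest terms, the values at 1 of consecutive Hermite polynomials satisfy the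
  equation excluded above, unless the smaller multiplicity is 0.\<close>

lemma smallest_even_multiplicity:
  assumes "finite S" "D \<in> S" and S: "\<And>d. d \<in> S \<Longrightarrow> even d \<and> D \<le> d" and "D > 0"
    and eq: "(1 - monom 1 D) * (\<Prod>d\<in>S. part_factor (N d) d) = g * (\<Prod>d\<in>S. part_factor (M d) d)"
    and g: "two_terms D g 1 0" and rg: "log_coeff D (reflect_poly g) 0"
  shows "M D = 1 \<and> N D = 0"
proof -
  have even: "even D" using S assms(2) by blast
  have dS: "d > D" if "d \<in> S" "d \<noteq> D" for d using S[OF that(1)] that(2) by simp
  have pos: "d > 0" if "d \<in> S" for d using S[OF that] assms(4) by simp
  define h where "h m = poly (hermite_neg m (int D)) 1" for m
  have h_rec: "h (Suc m) = h m + int D * int m * h (m - 1)" for m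
    by (simp add: h_def hermite_value_rec)
  have h_odd: "odd (h m)" for m
    unfolding h_def by (rule odd_hermite_value) (simp add: even)
  have top: "log_coeff D (reflect_poly (\<Prod>d\<in>S. part_factor (K d) d)) (- int (K D))" for K
    unfolding reflect_poly_prod using assms(1,2,4) even
    by (intro log_coeff_prod_first[where x = D] log_coeff_reflect_even)
       (auto intro!: log_coeff_truncate[OF assms(4) dS log_coeff_reflect_even] simp: S pos)
  have "log_coeff D (reflect_poly (1 - monom 1 D)) (-1)"
    using log_coeff_reflect_even[OF even assms(4), of 1] even by (simp only: part_factor_1) simp
  from log_coeff_mult[OF assms(4) this top[of N]] log_coeff_mult[OF assms(4) rg top[of M]]
  have "-1 + - int (N D) = 0 + - int (M D)"
    unfolding reflect_poly_mult[symmetric] eq by (rule log_coeff_unique[OF assms(4)])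
  then have MN: "M D = Suc (N D)" by simp
  define K where "K F = (\<Prod>d\<in>S - {D}. poly (hermite_neg (F d) (int d)) 1)" for F :: "nat \<Rightarrow> nat"
  have K_odd: "odd (K F)" for F
  proof -
    have "odd (\<Prod>d\<in>T. poly (hermite_neg (F d) (int d)) 1)" if "T \<subseteq> S" for T
      using that by (induction T rule: infinite_finite_induct) (simp_all add: odd_hermite_value S)
    then show ?thesis unfolding K_def by blast
  qed
  have low: "two_terms D (\<Prod>d\<in>S. part_factor (F d) d) (h (F D) * K F)
      (K F * (- int (F D) * h (F D - 1)))" for F
  proof -
    have "two_terms D (\<Prod>d\<in>S - {D}. part_factor (F d) d) (K F) 0"
      unfolding K_def
      by (intro two_terms_prod assms(4) two_terms_truncate[OF assms(4) dS two_terms_part_factor_even])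
         (auto simp: S pos)
    from two_terms_mult[OF assms(4) two_terms_part_factor_even[OF even assms(4), of "F D"] this]
    show ?thesis
      unfolding prod.remove[OF assms(1,2)] h_def by simp
  qed
  \<comment> \<open>Constant term and coefficient of \<open>x^D\<close> in \<open>eq\<close>; \<open>K\<close> collects the constant terms of the larger sizes.\<close>
  have "h (N D) * K N = h (M D) * K M \<and>
      - (h (N D) * K N) + K N * (- int (N D) * h (N D - 1)) = K M * (- int (M D) * h (M D - 1))"
    using two_terms_unique[OF assms(4) two_terms_mult[OF assms(4) two_terms_monom[OF assms(4)] low[of N]],
        unfolded eq, OF two_terms_mult[OF assms(4) g low[of M]]]
    by simp
  then have e1: "h (N D) * K N = h (Suc (N D)) * K M"
    and e2: "K N * (h (N D) + int (N D) * h (N D - 1)) = K M * ((int (N D) + 1) * h (N D))"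
    by (simp_all add: MN algebra_simps)
  have "K N * ((h (N D) + int (N D) * h (N D - 1)) * h (Suc (N D))) =
      h (Suc (N D)) * K M * ((int (N D) + 1) * h (N D))"
    unfolding mult.assoc[symmetric, of "K N"] e2 by (simp only: mult_ac)
  also have "\<dots> = K N * ((int (N D) + 1) * (h (N D))\<^sup>2)"
    unfolding e1[symmetric] by (simp add: algebra_simps power2_eq_square)
  finally have "(h (N D) + int (N D) * h (N D - 1)) * h (Suc (N D)) = (int (N D) + 1) * (h (N D))\<^sup>2"
    using K_odd[of N] by auto
  then have "N D = 0"
    using hermite_value_ratio[OF h_rec h_odd] even assms(4) by simp
  with MN show ?thesis by simp
qed

section \<open>Separating odd and even sizes\<close>

lemma poly_cpoly_part_factor:
  "poly (cpoly (part_factor m d)) z =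
     poly (hermite_neg m (of_nat d)) (if even d then 1 - z ^ d else z ^ d)"
  by (simp add: part_factor_def cpoly_pcompose cpoly_hermite_neg poly_pcompose cpoly_diff
      map_poly_monom poly_monom)

text \<open>Over the complex numbers, coprime means to have no common zero; the linear factors of \<open>p\<close> are
  cancelled against those of \<open>q\<close> one at a time.\<close>

lemma dvd_mult_no_common_zero:
  fixes p q r :: "complex poly"
  assumes "p \<noteq> 0" and "p dvd q * r" and "\<And>z. poly p z = 0 \<Longrightarrow> poly r z \<noteq> 0"
  shows "p dvd q"
  using assms
proof (induction "degree p" arbitrary: p q)
  case 0
  then obtain c where "p = [:c:]" by (metis degree_eq_zeroE)
  with 0(2) have "is_unit p" by (simp add: is_unit_const_poly_iff dvd_field_iff)
  then show ?case by (rule unit_imp_dvd)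
next
  case (Suc n)
  have "\<not> constant (poly p)" using Suc(2) by (simp add: constant_degree)
  then obtain z where z: "poly p z = 0"
    using fundamental_theorem_of_algebra by blast
  then obtain p' where p: "p = [:-z, 1:] * p'" by (metis poly_eq_0_iff_dvd dvdE)
  have "poly (q * r) z = 0" using Suc(4) z by (metis dvdE mult_zero_left poly_mult)
  with Suc(5)[OF z] have "poly q z = 0" by simp
  then obtain q' where q: "q = [:-z, 1:] * q'" by (metis poly_eq_0_iff_dvd dvdE)
  have nz: "[:-z, 1:] \<noteq> 0" "p' \<noteq> 0" using Suc(3) p by auto
  then have "degree p = Suc (degree p')" unfolding p by (subst degree_mult_eq) auto
  moreover have "p' dvd q' * r"
    using Suc(4) nz(1) unfolding p q mult.assoc by (simp only: dvd_mult_cancel_left simp_thms)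
  moreover have "poly r x \<noteq> 0" if "poly p' x = 0" for x
    using Suc(5)[of x] that by (simp add: p)
  ultimately have "p' dvd q'" using Suc(1)[of p' q'] Suc(2) nz(2) by simp
  then show ?case unfolding p q by (intro mult_dvd_mono) simp_all
qed

lemma monic_dvd_antisym:
  fixes p q :: "'a::idom poly"
  assumes "p dvd q" "q dvd p" "lead_coeff p = 1" "lead_coeff q = 1"
  shows "p = q"
proof -
  obtain k where k: "q = p * k" using assms(1) by blast
  have nz: "p \<noteq> 0" "q \<noteq> 0" using assms(3,4) by auto
  then have "k \<noteq> 0" using k by auto
  have "degree q \<le> degree p" using assms(2) nz by (intro dvd_imp_degree)
  then have "degree k = 0" using nz \<open>k \<noteq> 0\<close> by (simp add: k degree_mult_eq)
  then obtain c where "k = [:c:]" by (auto elim: degree_eq_zeroE)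
  moreover have "lead_coeff k = 1" using assms(3,4) by (simp add: k lead_coeff_mult)
  ultimately show ?thesis using k by simp
qed

text \<open>The set \<open>S\<close> is any finite set of sizes containing the parts.  A set common to two
  partitions allows their products to be compared size by size.\<close>

definition odd_factor :: "nat set \<Rightarrow> (nat \<Rightarrow> nat) \<Rightarrow> int poly" where
  "odd_factor S M = (\<Prod>d\<in>{d \<in> S. odd d}. part_factor (M d) d)"

definition even_factor :: "nat set \<Rightarrow> (nat \<Rightarrow> nat) \<Rightarrow> int poly" where
  "even_factor S M = (\<Prod>d\<in>{d \<in> S. even d}. part_factor (M d) d)"

context
  fixes S :: "nat set"
  assumes S: "finite S" "1 \<in> S" "0 \<notin> S"
begin

lemma odd_factor_zero:
  assumes "poly (cpoly (odd_factor S M)) z = 0"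
  obtains d where "d \<in> S" "odd d" "poly (hermite_neg (M d) (of_nat d)) (z ^ d) = 0"
  using assms S(1) by (auto simp: odd_factor_def cpoly_prod poly_prod poly_cpoly_part_factor)

lemma even_factor_zero:
  assumes "poly (cpoly (even_factor S M)) z = 0"
  obtains d where "d \<in> S" "even d" "poly (hermite_neg (M d) (of_nat d)) (1 - z ^ d) = 0"
  using assms S(1) by (auto simp: even_factor_def cpoly_prod poly_prod poly_cpoly_part_factor)

text \<open>Apart from one possible factor \<open>x\<^sup>2 + 1\<close>, which comes from the size 1, the odd product has no
  zero in common with any even product.\<close>

lemma odd_factor_decomposition:
  obtains \<epsilon> :: nat and A :: "complex poly"
  where "\<epsilon> \<le> 1" "cpoly (odd_factor S M) = [:1, 0, 1:] ^ \<epsilon> * A" "lead_coeff A = 1"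
    "\<And>z. poly A z = 0 \<Longrightarrow> z\<^sup>2 \<noteq> -1"
    "\<And>z N. poly A z = 0 \<Longrightarrow> poly (cpoly (even_factor S N)) z \<noteq> 0"
proof -
  obtain \<epsilon> :: nat and Q :: "complex poly"
    where Q: "\<epsilon> \<le> 1" "hermite_neg (M 1) 1 = [:1, 0, 1:] ^ \<epsilon> * Q" "\<And>z. z\<^sup>2 = -1 \<Longrightarrow> poly Q z \<noteq> 0"
    using hermite_neg_split_off_x2_plus_1[of "M 1"] by blast
  define R where "R = (\<Prod>d\<in>{d \<in> S. odd d} - {1}. cpoly (part_factor (M d) d))"
  define A where "A = Q * R"
  have "cpoly (part_factor (M 1) 1) = hermite_neg (M 1) 1"
    using cpoly_hermite_neg[of "M 1" 1] by (simp add: part_factor_def monom_1_1)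
  then have "cpoly (odd_factor S M) = hermite_neg (M 1) 1 * R"
    unfolding odd_factor_def cpoly_prod R_def
    using S by (subst prod.remove[of _ 1]) auto
  then have eq: "cpoly (odd_factor S M) = [:1, 0, 1:] ^ \<epsilon> * A"
    by (simp only: Q(2) A_def mult.assoc)
  have "lead_coeff (odd_factor S M) = 1"
    unfolding odd_factor_def lead_coeff_prod
    by (intro prod.neutral) (simp add: monic_part_factor_odd)
  then have "lead_coeff (cpoly (odd_factor S M)) = 1"
    by (simp add: lead_coeff_map_poly_nz)
  then have lead: "lead_coeff A = 1"
    by (simp add: eq lead_coeff_mult lead_coeff_power)
  have not_i: "z\<^sup>2 \<noteq> -1" if "poly A z = 0" for z
  proof
    assume z: "z\<^sup>2 = -1"
    with that Q(3) have "poly R z = 0" by (simp add: A_def)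
    then obtain d where d: "d \<in> S" "odd d" "d \<noteq> 1" "poly (hermite_neg (M d) (of_nat d)) (z ^ d) = 0"
      using S(1) by (auto simp: R_def poly_prod poly_cpoly_part_factor)
    have "(z ^ d)\<^sup>2 = (z\<^sup>2) ^ d" by (simp add: mult.commute flip: power_mult)
    also have "\<dots> = -1" using z d(2) by simp
    finally have "d = 1" by (rule hermite_neg_zero_sqrt_minus_1[OF d(4)])
    with d(3) show False by simp
  qed
  have no_even: "poly (cpoly (even_factor S N)) z \<noteq> 0" if "poly A z = 0" for z N
  proof
    assume "poly (cpoly (even_factor S N)) z = 0"
    then obtain e where e: "e \<in> S" "even e" "poly (hermite_neg (N e) (of_nat e)) (1 - z ^ e) = 0"
      by (rule even_factor_zero)
    have "poly (cpoly (odd_factor S M)) z = 0" using that by (simp add: eq)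
    then obtain d where d: "d \<in> S" "odd d" "poly (hermite_neg (M d) (of_nat d)) (z ^ d) = 0"
      by (rule odd_factor_zero)
    have "e > 0" using e(1) S(3) by (cases e) auto
    then have "z\<^sup>2 = -1" using common_zero[OF d(2) e(2) _ d(3) e(3)] by simp
    with not_i[OF that] show False by simp
  qed
  show ?thesis by (rule that[OF Q(1) eq lead not_i no_even])
qed

lemma cpoly_x2_plus_1: "cpoly [:1, 0, 1:] = [:1, 0, 1:]"
  by (simp add: map_poly_pCons)

text \<open>Having no zeros in common with the other factors forces the parts of the odd products that are free of \<open>x\<^sup>2 + 1\<close> to divide each other, hence to be
  equal.  So the odd products agree, or one has an additional factor \<open>x\<^sup>2 + 1\<close>, which the other
  side must then have in its even product.\<close>

lemma odd_even_separation:
  assumes eq: "odd_factor S M * even_factor S M = odd_factor S N * even_factor S N"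
  shows "odd_factor S M = odd_factor S N \<and> even_factor S M = even_factor S N \<or>
    odd_factor S M = [:1, 0, 1:] * odd_factor S N \<and> even_factor S N = [:1, 0, 1:] * even_factor S M \<or>
    odd_factor S N = [:1, 0, 1:] * odd_factor S M \<and> even_factor S M = [:1, 0, 1:] * even_factor S N"
proof -
  let ?X = "[:1, 0, 1:] :: complex poly"
  obtain \<epsilon> :: nat and A where A: "\<epsilon> \<le> 1" "cpoly (odd_factor S M) = ?X ^ \<epsilon> * A" "lead_coeff A = 1"
    "\<And>z. poly A z = 0 \<Longrightarrow> z\<^sup>2 \<noteq> -1"
    "\<And>z N. poly A z = 0 \<Longrightarrow> poly (cpoly (even_factor S N)) z \<noteq> 0"
    using odd_factor_decomposition[of M] by blast
  obtain \<delta> :: nat and B where B: "\<delta> \<le> 1" "cpoly (odd_factor S N) = ?X ^ \<delta> * B" "lead_coeff B = 1"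
    "\<And>z. poly B z = 0 \<Longrightarrow> z\<^sup>2 \<noteq> -1"
    "\<And>z N. poly B z = 0 \<Longrightarrow> poly (cpoly (even_factor S N)) z \<noteq> 0"
    using odd_factor_decomposition[of N] by blast
  have X: "poly ?X z = 0 \<longleftrightarrow> z\<^sup>2 = -1" for z
    by (simp add: power2_eq_square add_eq_0_iff)
  have prod_eq: "A * (?X ^ \<epsilon> * cpoly (even_factor S M)) = B * (?X ^ \<delta> * cpoly (even_factor S N))"
    using arg_cong[OF eq, of cpoly] by (simp only: cpoly_mult A(2) B(2) mult_ac)
  have nz: "A \<noteq> 0" "B \<noteq> 0" using A(3) B(3) by auto
  have "A dvd B"
  proof (rule dvd_mult_no_common_zero[OF nz(1)])
    show "A dvd B * (?X ^ \<delta> * cpoly (even_factor S N))"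
      unfolding prod_eq[symmetric] by (rule dvd_triv_left)
  qed (use A(4,5) in \<open>simp add: X del: poly_pCons\<close>)
  have "B dvd A"
  proof (rule dvd_mult_no_common_zero[OF nz(2)])
    show "B dvd A * (?X ^ \<epsilon> * cpoly (even_factor S M))"
      unfolding prod_eq by (rule dvd_triv_left)
  qed (use B(4,5) in \<open>simp add: X del: poly_pCons\<close>)
  with \<open>A dvd B\<close> have "A = B"
    by (rule monic_dvd_antisym[OF _ _ A(3) B(3)])
  with prod_eq nz
  have ev: "?X ^ \<epsilon> * cpoly (even_factor S M) = ?X ^ \<delta> * cpoly (even_factor S N)" by simp
  have "\<epsilon> = \<delta> \<or> \<epsilon> = 1 \<and> \<delta> = 0 \<or> \<epsilon> = 0 \<and> \<delta> = 1" using A(1) B(1) by linarith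
  then show ?thesis
  proof (elim disjE conjE)
    assume "\<epsilon> = \<delta>"
    with ev A(2) B(2) \<open>A = B\<close> have "cpoly (odd_factor S M) = cpoly (odd_factor S N)"
      "cpoly (even_factor S M) = cpoly (even_factor S N)" by simp_all
    then show ?thesis by (simp add: cpoly_eq_iff)
  next
    assume "\<epsilon> = 1" "\<delta> = 0"
    with ev A(2) B(2) \<open>A = B\<close>
    have "cpoly (odd_factor S M) = cpoly ([:1, 0, 1:] * odd_factor S N)"
      "cpoly (even_factor S N) = cpoly ([:1, 0, 1:] * even_factor S M)"
      unfolding cpoly_mult cpoly_x2_plus_1 by simp_all
    then show ?thesis unfolding cpoly_eq_iff by simp
  next
    assume "\<epsilon> = 0" "\<delta> = 1"
    with ev A(2) B(2) \<open>A = B\<close>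
    have "cpoly (odd_factor S N) = cpoly ([:1, 0, 1:] * odd_factor S M)"
      "cpoly (even_factor S M) = cpoly ([:1, 0, 1:] * even_factor S N)"
      unfolding cpoly_mult cpoly_x2_plus_1 by simp_all
    then show ?thesis unfolding cpoly_eq_iff by simp
  qed
qed

section \<open>Multiplicities in the exceptional case\<close>

text \<open>The factor \<open>x\<^sup>2 + 1\<close> is the contribution of two parts of size 1.  By the coefficient for size 1, the two triangular numbers
  there differ by 1, which leaves only multiplicity 2 against at most 1.  The remaining sizes follow
  after cancellation.\<close>

lemma exceptional_odd_multiplicities:
  assumes eq: "odd_factor S M = [:1, 0, 1:] * odd_factor S N"
  shows "M 1 = 2 \<and> N 1 \<le> 1 \<and>
    (\<forall>d\<in>S. odd d \<longrightarrow> d \<noteq> 1 \<longrightarrow> M d = N d \<or> (M d \<le> 1 \<and> N d \<le> 1))"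
proof -
  let ?O = "{d \<in> S. odd d}"
  have fin: "finite ?O" "1 \<in> ?O" using S by auto
  have top: "log_coeff 2 (reflect_poly (odd_factor S F)) (int (F 1 choose 2))" for F
    unfolding odd_factor_def reflect_poly_prod
  proof (rule log_coeff_prod_first[OF fin])
    show "log_coeff 2 (reflect_poly (part_factor (F 1) 1)) (int (F 1 choose 2))"
      using log_coeff_reflect_odd[of 1 "F 1"] by simp
  next
    fix d assume "d \<in> ?O" "d \<noteq> 1"
    then have "2 < 2 * d" using S(3) by (cases d) auto
    with \<open>d \<in> ?O\<close> show "log_coeff 2 (reflect_poly (part_factor (F d) d)) 0"
      by (intro log_coeff_truncate[OF _ _ log_coeff_reflect_odd]) auto
  qed simp
  have "log_coeff 2 (reflect_poly [:1, 0, 1:]) 1"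
    using log_coeff_reflect_odd[of 1 2] by (simp only: part_factor_2_1) simp
  from log_coeff_mult[OF _ this top[of N]]
  have "log_coeff 2 (reflect_poly (odd_factor S M)) (1 + int (N 1 choose 2))"
    unfolding eq reflect_poly_mult by simp
  with top[of M] have "int (M 1 choose 2) = 1 + int (N 1 choose 2)"
    by (rule log_coeff_unique[rotated]) simp
  then have "M 1 choose 2 = Suc (N 1 choose 2)" by simp
  then have one: "M 1 = 2" "N 1 \<le> 1" using choose_two_eq_Suc by auto
  define R where "R F = (\<Prod>d\<in>?O - {1}. part_factor (F d) d)" for F
  have split: "odd_factor S F = part_factor (F 1) 1 * R F" for F
    unfolding odd_factor_def R_def by (rule prod.remove[OF fin])
  have "[:1, 0, 1:] * R M = [:1, 0, 1:] * (part_factor (N 1) 1 * R N)"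
    using eq unfolding split one(1) part_factor_2_1 by (simp only: mult_ac)
  moreover have "[:1, 0, 1:] \<noteq> (0 :: int poly)" by simp
  ultimately have "R M = part_factor (N 1) 1 * R N"
    by (simp only: mult_cancel_left simp_thms)
  then have "reflect_poly (R M) = reflect_poly (part_factor (N 1) 1) * reflect_poly (R N)"
    by (simp only: reflect_poly_mult)
  also have "reflect_poly (part_factor (N 1) 1) = 1"
    using one(2) reflect_part_factor_odd_1[of 1] by (cases "N 1") auto
  finally have "reflect_poly (R M) = reflect_poly (R N)" by simp
  then have reflect_eq: "reflect_poly (\<Prod>d\<in>?O - {1}. part_factor (M d) d) =
      reflect_poly (\<Prod>d\<in>?O - {1}. part_factor (N d) d)"
    by (simp only: R_def)
  have "M d = N d \<or> (M d \<le> 1 \<and> N d \<le> 1)" if "d \<in> S" "odd d" "d \<noteq> 1" for d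
    by (rule odd_multiplicities_determined[OF _ _ reflect_eq]) (use fin(1) that in auto)
  with one show ?thesis by blast
qed

text \<open>Multiplied by \<open>1 - x\<^sup>2\<close>, the relation reads \<open>(1 - x\<^sup>2) B\<^sub>N = (1 - x^4) B\<^sub>M\<close>.  Size 2 decides the
  multiplicities of 2; then these factors cancel and the same argument applies to size 4 with the roles exchanged.\<close>

lemma exceptional_even_multiplicities:
  assumes "2 \<in> S" "4 \<in> S" and eq: "even_factor S N = [:1, 0, 1:] * even_factor S M"
  shows "M 2 = 1 \<and> N 2 = 0 \<and> M 4 = 0 \<and> N 4 = 1 \<and>
    (\<forall>d\<in>S. even d \<longrightarrow> d \<noteq> 2 \<longrightarrow> d \<noteq> 4 \<longrightarrow> M d = N d)"
proof -
  let ?E = "{d \<in> S. even d}"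
  have fin: "finite ?E" "2 \<in> ?E" "4 \<in> ?E - {2}" using S assms(1,2) by auto
  have ge2: "even d \<and> 2 \<le> d" if "d \<in> ?E" for d
    using that S(3) by (cases "d = 0") (auto elim!: evenE)
  have ge4: "even d \<and> 4 \<le> d" if "d \<in> ?E - {2}" for d
    using that S(3) by (cases "d = 0") (auto elim!: evenE)
  have factor: "(1 - monom 1 2) * [:1, 0, 1:] = (1 - monom 1 4 :: int poly)"
    by (simp add: numeral_eq_Suc monom_Suc monom_0 one_pCons)
  have E2: "(1 - monom 1 2) * even_factor S N = (1 - monom 1 4) * even_factor S M"
    unfolding eq factor[symmetric] by (simp only: mult.assoc)
  have "log_coeff 4 (reflect_poly (1 - monom 1 4)) (-1)"
    using log_coeff_reflect_even[of 4 1] by (simp only: part_factor_1) simp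
  then have top4: "log_coeff 2 (reflect_poly (1 - monom 1 4)) 0"
    by (intro log_coeff_truncate[of 2 4]) auto
  have low4: "two_terms 2 (1 - monom 1 4) 1 0"
    by (intro two_terms_truncate[OF _ _ two_terms_monom[of 4]]) auto
  have two: "M 2 = 1" "N 2 = 0"
    using smallest_even_multiplicity[OF fin(1,2) ge2 _ E2[unfolded even_factor_def] low4 top4] by auto
  define E where "E F = (\<Prod>d\<in>?E - {2}. part_factor (F d) d)" for F
  have split: "even_factor S F = part_factor (F 2) 2 * E F" for F
    unfolding even_factor_def E_def by (rule prod.remove[OF fin(1,2)])
  have "even_factor S M = (1 - monom 1 2) * E M" "even_factor S N = E N"
    unfolding split two part_factor_1 by simp_all
  then have "(1 - monom 1 2) * ((1 - monom 1 4) * E M) = (1 - monom 1 2) * (1 * E N)"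
    using E2 by (simp only: mult_ac mult_1)
  moreover have "1 - monom 1 2 \<noteq> (0 :: int poly)"
    using degree_1_minus_monom[of 2] by (metis degree_0 zero_neq_numeral)
  ultimately have E4: "(1 - monom 1 4) * E M = 1 * E N"
    by (simp only: mult_cancel_left) simp
  \<comment> \<open>The roles of \<open>M\<close> and \<open>N\<close> are exchanged, and \<open>g = 1\<close>.\<close>
  have four: "N 4 = 1" "M 4 = 0"
    using smallest_even_multiplicity[OF _ fin(3) ge4 _ E4[unfolded E_def]] fin(1)
    by (auto simp: two_terms_iff log_coeff_1)
  define G where "G F = (\<Prod>d\<in>?E - {2} - {4}. part_factor (F d) d)" for F
  have split4: "E F = part_factor (F 4) 4 * G F" for F
    unfolding E_def G_def by (rule prod.remove) (use fin in auto)
  have "(1 - monom 1 4) * G M = (1 - monom 1 4) * G N"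
    using E4 unfolding split4 four part_factor_1 by simp
  moreover have "1 - monom 1 4 \<noteq> (0 :: int poly)"
    using degree_1_minus_monom[of 4] by (metis degree_0 zero_neq_numeral)
  ultimately have G_eq: "(\<Prod>d\<in>?E - {2} - {4}. part_factor (M d) d) =
      (\<Prod>d\<in>?E - {2} - {4}. part_factor (N d) d)"
    by (simp only: G_def mult_cancel_left simp_thms)
  have pos: "even d \<and> d > 0" if "d \<in> ?E - {2} - {4}" for d
    using ge2[of d] that by simp
  have "M d = N d" if "d \<in> S" "even d" "d \<noteq> 2" "d \<noteq> 4" for d
    by (rule even_multiplicities_determined[OF _ pos G_eq]) (use fin(1) that in auto)
  with two four show ?thesis by blast
qed

end

section \<open>Partition polynomials and the two operations\<close>

lemma partition_poly_eq_prod: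
  assumes "finite S" "set_mset p \<subseteq> S"
  shows "partition_poly p = (\<Prod>d\<in>S. part_factor (count p d) d)"
proof -
  let ?E = "{d \<in> set_mset p. even d}" and ?O = "{d \<in> set_mset p. odd d}"
  have "partition_poly p = (\<Prod>d\<in>?E. part_factor (count p d) d) * (\<Prod>d\<in>?O. part_factor (count p d) d)"
    unfolding partition_poly_def by (intro arg_cong2[of _ _ _ _ "(*)"] prod.cong) (auto simp: part_factor_def)
  also have "\<dots> = (\<Prod>d\<in>?E \<union> ?O. part_factor (count p d) d)"
    by (rule prod.union_disjoint[symmetric]) auto
  also have "?E \<union> ?O = set_mset p" by auto
  also have "(\<Prod>d\<in>set_mset p. part_factor (count p d) d) = (\<Prod>d\<in>S. part_factor (count p d) d)"
    using assms by (intro prod.mono_neutral_left) (auto simp: not_in_iff)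
  finally show ?thesis .
qed

lemma partition_poly_eq_odd_even:
  assumes "finite S" "set_mset p \<subseteq> S"
  shows "partition_poly p = odd_factor S (count p) * even_factor S (count p)"
proof -
  have "partition_poly p = (\<Prod>d\<in>{d \<in> S. odd d} \<union> {d \<in> S. even d}. part_factor (count p d) d)"
    using assms by (subst partition_poly_eq_prod[OF assms]) (intro prod.cong, auto)
  also have "\<dots> = odd_factor S (count p) * even_factor S (count p)"
    unfolding odd_factor_def even_factor_def using assms(1) by (intro prod.union_disjoint) auto
  finally show ?thesis .
qed

lemma sum_mset_eq_sum_count:
  assumes "finite S" "set_mset p \<subseteq> S"
  shows "\<Sum>\<^sub># p = (\<Sum>d\<in>S. count p d * d)"
  using assms(2)
proof (induction p)
  case (add x p)
  have "(\<Sum>d\<in>S. count (add_mset x p) d * d) = (\<Sum>d\<in>S. count p d * d + (if d = x then d else 0))"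
    by (intro sum.cong) auto
  also have "\<dots> = (\<Sum>d\<in>S. count p d * d) + x"
    using add.prems assms(1) by (simp add: sum.distrib)
  finally show ?case using add by simp
qed simp

text \<open>Through this, equality of the polynomials supplies the sum condition of the first operation.\<close>

lemma degree_partition_poly:
  assumes "is_partition p"
  shows "degree (partition_poly p) = \<Sum>\<^sub># p"
proof -
  have "d > 0" if "d \<in># p" for d
    using assms that by (cases d) (auto simp: is_partition_def)
  then show ?thesis
    by (simp add: partition_poly_eq_prod[of "set_mset p"] degree_prod_eq_sum_degree part_factor_nonzero
        degree_part_factor sum_mset_eq_sum_count[of "set_mset p"])
qed

lemma partition_poly_operation1:
  assumes "operation1 p q"
  shows "partition_poly p = partition_poly q"
proof -
  obtain A B where AB: "finite A" "finite B" "\<And>a. a \<in> A \<Longrightarrow> odd a \<and> count p a = 1"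
    "\<And>b. b \<in> B \<Longrightarrow> odd b \<and> count p b = 0" "\<Sum>A = \<Sum>B"
    and q: "q = p - mset_set A + mset_set B"
    using assms unfolding operation1_def by blast
  define S where "S = set_mset p \<union> A \<union> B"
  have S: "finite S" "set_mset p \<subseteq> S" "A \<subseteq> S" "B \<subseteq> S"
    using AB(1,2) by (auto simp: S_def)
  have Sq: "set_mset q \<subseteq> S"
    unfolding q S_def using AB(2) by (auto dest: in_diffD)
  have monoms: "(\<Prod>d\<in>C. monom 1 d) = (monom 1 (\<Sum>C) :: int poly)" if "finite C" for C :: "nat set"
    using that by (induction C rule: finite_induct) (simp_all add: mult_monom one_pCons monom_0)
  have "part_factor (count q d) d * (if d \<in> A then monom 1 d else 1) =
      part_factor (count p d) d * (if d \<in> B then monom 1 d else 1)" for d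
  proof -
    consider "d \<in> A" "d \<notin> B" | "d \<notin> A" "d \<in> B" | "d \<notin> A" "d \<notin> B"
      using AB(3,4) by fastforce
    then show ?thesis
    proof cases
      case 1
      then have "count q d = 0" using AB by (simp add: q)
      moreover have "part_factor (count p d) d = monom 1 d"
        using 1 AB(3) by (simp only: part_factor_1) simp
      ultimately show ?thesis using 1 by simp
    next
      case 2
      then have "part_factor (count q d) d = monom 1 d" "count p d = 0"
        using AB by (simp_all add: q part_factor_1[unfolded One_nat_def])
      with 2 show ?thesis by simp
    next
      case 3
      then show ?thesis using AB(1,2) by (simp add: q)
    qed
  qed
  then have "(\<Prod>d\<in>S. part_factor (count q d) d) * (\<Prod>d\<in>S. if d \<in> A then monom 1 d else 1) =
      (\<Prod>d\<in>S. part_factor (count p d) d) * (\<Prod>d\<in>S. if d \<in> B then monom 1 d else 1)"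
    by (simp flip: prod.distrib)
  moreover have "(\<Prod>d\<in>S. if d \<in> A then monom 1 d else 1) = (monom 1 (\<Sum>A) :: int poly)"
    using S AB by (simp add: prod.inter_restrict[symmetric] Int_absorb1 monoms)
  moreover have "(\<Prod>d\<in>S. if d \<in> B then monom 1 d else 1) = (monom 1 (\<Sum>A) :: int poly)"
    using S AB by (simp add: prod.inter_restrict[symmetric] Int_absorb1 monoms)
  moreover have "monom 1 (\<Sum>A) \<noteq> (0 :: int poly)" by (simp add: monom_eq_0_iff)
  ultimately have "(\<Prod>d\<in>S. part_factor (count q d) d) = (\<Prod>d\<in>S. part_factor (count p d) d)"
    by simp
  then show ?thesis
    using S(1,2) Sq by (simp add: partition_poly_eq_prod)
qed

text \<open>The identity behind it is \<open>1 - x^4 = (1 + x\<^sup>2) (1 - x\<^sup>2)\<close>.\<close>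

lemma partition_poly_operation2:
  assumes "operation2 p q"
  shows "partition_poly p = partition_poly q"
proof -
  have c: "count p 4 = 1" "count p 2 = 0" "count p 1 = 0" and q: "q = p - {#4#} + {#2, 1, 1#}"
    using assms unfolding operation2_def by auto
  have cq: "count q 4 = 0" "count q 2 = 1" "count q 1 = 2"
    "\<And>d. d \<notin> {1, 2, 4} \<Longrightarrow> count q d = count p d"
    using c by (simp_all add: q)
  define S where "S = set_mset p \<union> {1, 2, 4}"
  have S: "finite S" "set_mset p \<subseteq> S" "{1, 2, 4} \<subseteq> S" by (auto simp: S_def)
  have Sq: "set_mset q \<subseteq> S"
    unfolding q S_def by (auto dest: in_diffD)
  have split: "(\<Prod>d\<in>S. part_factor (F d) d) =
      (\<Prod>d\<in>S - {1, 2, 4}. part_factor (F d) d) *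
      (part_factor (F 1) 1 * (part_factor (F 2) 2 * part_factor (F 4) 4))" for F
    unfolding prod.subset_diff[OF S(3,1)] by (simp add: mult_ac)
  have "(1 - monom 1 4 :: int poly) = [:1, 0, 1:] * (1 - monom 1 2)"
    by (simp add: numeral_eq_Suc monom_Suc monom_0 one_pCons)
  then have special: "part_factor (count p 1) 1 * (part_factor (count p 2) 2 * part_factor (count p 4) 4) =
      part_factor (count q 1) 1 * (part_factor (count q 2) 2 * part_factor (count q 4) 4)"
    unfolding c cq(1-3) part_factor_2_1 part_factor_1 by simp
  have rest: "(\<Prod>d\<in>S - {1, 2, 4}. part_factor (count p d) d) =
      (\<Prod>d\<in>S - {1, 2, 4}. part_factor (count q d) d)"
    by (intro prod.cong) (auto simp: cq(4))
  show ?thesis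
    unfolding partition_poly_eq_prod[OF S(1,2)] partition_poly_eq_prod[OF S(1) Sq] split special rest ..
qed

lemma partition_poly_invariant:
  assumes "p \<sim>\<^sub>p q"
  shows "partition_poly p = partition_poly q"
  using assms unfolding partition_equiv_def
  by (induction rule: equivclp_induct)
     (auto dest: partition_poly_operation1 partition_poly_operation2)

lemma partition_equiv_sym: "p \<sim>\<^sub>p q \<Longrightarrow> q \<sim>\<^sub>p p"
  unfolding partition_equiv_def by (rule equivclp_sym)

lemma partition_equiv_trans: "p \<sim>\<^sub>p q \<Longrightarrow> q \<sim>\<^sub>p r \<Longrightarrow> p \<sim>\<^sub>p r"
  unfolding partition_equiv_def by (rule equivclp_trans)

text \<open>If the multiplicities agree except that, for odd sizes, 0 and 1 may be interchanged, the sizes where they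
  differ are exactly what the first operation removes and inserts.\<close>

lemma operation1I:
  assumes "is_partition p" and sum: "\<Sum>\<^sub># p = \<Sum>\<^sub># q"
    and even: "\<And>d. even d \<Longrightarrow> count p d = count q d"
    and odd: "\<And>d. odd d \<Longrightarrow> count p d = count q d \<or> (count p d \<le> 1 \<and> count q d \<le> 1)"
  shows "operation1 p q"
proof -
  define A where "A = {d. count p d = 1 \<and> count q d = 0}"
  define B where "B = {d. count p d = 0 \<and> count q d = 1}"
  have "A \<subseteq> set_mset p" "B \<subseteq> set_mset q"
    by (auto simp: A_def B_def simp flip: count_greater_zero_iff)
  then have fin: "finite A" "finite B" by (auto intro: finite_subset)
  have odd_AB: "odd d" if "d \<in> A \<union> B" for d
    using that even[of d] by (auto simp: A_def B_def)
  have cases: "count p d = count q d \<or> d \<in> A \<or> d \<in> B" for d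
  proof (cases "count p d = count q d")
    case False
    then have "count p d \<le> 1 \<and> count q d \<le> 1" using even[of d] odd[of d] by blast
    with False have "count p d = 1 \<and> count q d = 0 \<or> count p d = 0 \<and> count q d = 1"
      by linarith
    then show ?thesis unfolding A_def B_def by blast
  qed simp
  have q: "q = p - mset_set A + mset_set B"
  proof (rule multiset_eqI)
    fix d
    have rhs: "count (p - mset_set A + mset_set B) d =
        count p d - (if d \<in> A then 1 else 0) + (if d \<in> B then 1 else 0)"
      using fin by (simp add: count_mset_set')
    consider "d \<in> A" | "d \<in> B" | "d \<notin> A" "d \<notin> B" "count p d = count q d"
      using cases[of d] by blast
    then show "count q d = count (p - mset_set A + mset_set B) d"
    proof cases
      case 1
      then have "count p d = 1" "count q d = 0" "d \<notin> B" unfolding A_def B_def by auto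
      then show ?thesis using 1 unfolding rhs by simp
    next
      case 2
      then have "count p d = 0" "count q d = 1" "d \<notin> A" unfolding A_def B_def by auto
      then show ?thesis using 2 unfolding rhs by simp
    next
      case 3
      then show ?thesis unfolding rhs by simp
    qed
  qed
  have "mset_set A \<subseteq># p"
    by (rule mset_subset_eqI) (auto simp: count_mset_set' A_def)
  then have "\<Sum>\<^sub># p = \<Sum>\<^sub># (p - mset_set A) + \<Sum>\<^sub># (mset_set A)"
    by (metis subset_mset.diff_add sum_mset.union)
  moreover have "\<Sum>\<^sub># q = \<Sum>\<^sub># (p - mset_set A) + \<Sum>\<^sub># (mset_set B)"
    by (subst q) simp
  ultimately have "\<Sum>A = \<Sum>B"
    using sum by (simp add: sum_unfold_sum_mset)
  moreover have "\<forall>a\<in>A. odd a \<and> count p a = 1" "\<forall>b\<in>B. odd b \<and> count p b = 0"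
    using odd_AB by (auto simp: A_def B_def)
  ultimately show ?thesis
    unfolding operation1_def using assms(1) fin q by blast
qed

text \<open>In the exceptional case \<open>p\<close> contains exactly the parts \<open>2, 1, 1\<close> among \<open>1, 2, 4\<close>.  Undoing the second operation gives
  \<open>r\<close>, which agrees with \<open>q\<close> up to single odd parts.  A possible part 1 of \<open>q\<close> causes no difficulty, since \<open>r\<close> has none.\<close>

lemma exceptional_equiv:
  assumes S: "finite S" "1 \<in> S" "0 \<notin> S" "2 \<in> S" "4 \<in> S" "set_mset p \<subseteq> S" "set_mset q \<subseteq> S"
    and parts: "is_partition p" "is_partition q" and sum: "\<Sum>\<^sub># p = \<Sum>\<^sub># q"
    and odd_eq: "odd_factor S (count p) = [:1, 0, 1:] * odd_factor S (count q)"
    and even_eq: "even_factor S (count q) = [:1, 0, 1:] * even_factor S (count p)"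
  shows "p \<sim>\<^sub>p q"
proof -
  have outside: "count p d = 0" "count q d = 0" if "d \<notin> S" for d
    using that S(6,7) by (auto simp flip: not_in_iff)
  have odds: "count p 1 = 2" "count q 1 \<le> 1"
    "\<And>d. d \<in> S \<Longrightarrow> odd d \<Longrightarrow> d \<noteq> 1 \<Longrightarrow> count p d = count q d \<or> (count p d \<le> 1 \<and> count q d \<le> 1)"
    using exceptional_odd_multiplicities[OF S(1-3) odd_eq] by blast+
  have evens: "count p 2 = 1" "count q 2 = 0" "count p 4 = 0" "count q 4 = 1"
    "\<And>d. d \<in> S \<Longrightarrow> even d \<Longrightarrow> d \<noteq> 2 \<Longrightarrow> d \<noteq> 4 \<Longrightarrow> count p d = count q d"
    using exceptional_even_multiplicities[OF S(1-5) even_eq] by blast+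
  define r where "r = p - {#2, 1, 1#} + {#4#}"
  have cr: "count r 1 = 0" "count r 2 = 0" "count r 4 = 1"
    "\<And>d. d \<notin> {1, 2, 4} \<Longrightarrow> count r d = count p d"
    using odds(1) evens(1,3) by (simp_all add: r_def)
  have sub: "{#2, 1, 1#} \<subseteq># p"
    by (rule mset_subset_eqI) (use odds(1) evens(1) in auto)
  have r: "is_partition r"
    using parts(1) by (auto simp: r_def is_partition_def dest: in_diffD)
  have "p = r - {#4#} + {#2, 1, 1#}"
    unfolding r_def using subset_mset.diff_add[OF sub] by simp
  with r cr have "operation2 r p"
    unfolding operation2_def by simp
  then have "r \<sim>\<^sub>p p"
    unfolding partition_equiv_def by (intro r_into_equivclp) simp
  have "\<Sum>\<^sub># p = \<Sum>\<^sub># (p - {#2, 1, 1#}) + \<Sum>\<^sub># {#2, 1, 1#}"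
    using sub by (metis subset_mset.diff_add sum_mset.union)
  then have "\<Sum>\<^sub># r = \<Sum>\<^sub># q"
    using sum by (simp add: r_def)
  moreover have "count r d = count q d" if "even d" for d
    using that cr evens outside[of d] by (cases "d \<in> {2, 4}"; cases "d \<in> S") auto
  moreover have "count r d = count q d \<or> (count r d \<le> 1 \<and> count q d \<le> 1)" if "odd d" for d
  proof (cases "d = 1")
    case False
    then have "d \<notin> {1, 2, 4}" using that by auto
    then have "count r d = count p d" by (rule cr(4))
    then show ?thesis
      using odds(3)[of d] outside[of d] that False by (metis order_refl)
  next
    case True
    have "count r 1 \<le> 1" by (simp only: cr(1))
    with True odds(2) show ?thesis by blast
  qed
  ultimately have "operation1 r q"
    using r by (intro operation1I) auto
  then have "r \<sim>\<^sub>p q"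
    unfolding partition_equiv_def by (intro r_into_equivclp) simp
  with \<open>r \<sim>\<^sub>p p\<close> show ?thesis
    using partition_equiv_sym partition_equiv_trans by blast
qed

theorem theorem7p9:
  fixes p q :: "nat multiset"
  assumes "is_partition p" and "is_partition q"
  shows "partition_poly p = partition_poly q \<longleftrightarrow> p \<sim>\<^sub>p q"
proof
  assume eq: "partition_poly p = partition_poly q"
  define S where "S = set_mset p \<union> set_mset q \<union> {1, 2, 4}"
  have S: "finite S" "1 \<in> S" "0 \<notin> S" "2 \<in> S" "4 \<in> S" "set_mset p \<subseteq> S" "set_mset q \<subseteq> S"
    using assms by (auto simp: S_def is_partition_def)
  have sum: "\<Sum>\<^sub># p = \<Sum>\<^sub># q"
    using eq assms by (simp flip: degree_partition_poly)
  have "odd_factor S (count p) * even_factor S (count p) =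
      odd_factor S (count q) * even_factor S (count q)"
    using eq S by (simp add: partition_poly_eq_odd_even)
  from odd_even_separation[OF S(1-3) this]
  show "p \<sim>\<^sub>p q"
  proof (elim disjE conjE)
    assume odd_eq: "odd_factor S (count p) = odd_factor S (count q)"
      and even_eq: "even_factor S (count p) = even_factor S (count q)"
    have outside: "count p d = count q d" if "d \<notin> S" for d
      using that S(6,7) by (metis not_in_iff subsetD)
    have evens: "count p d = count q d" if "even d" for d
    proof (cases "d \<in> S")
      case True
      show ?thesis
        by (rule even_multiplicities_determined[OF _ _ even_eq[unfolded even_factor_def]])
           (use S(1,3) True that in \<open>auto intro!: Nat.gr0I\<close>)
    qed (rule outside)
    have odds: "count p d = count q d \<or> (count p d \<le> 1 \<and> count q d \<le> 1)" if "odd d" for d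
    proof (cases "d \<in> S")
      case True
      show ?thesis
        by (rule odd_multiplicities_determined[OF _ _ arg_cong[OF odd_eq[unfolded odd_factor_def], of reflect_poly]])
           (use S(1) True that in auto)
    qed (simp add: outside)
    have "operation1 p q"
      by (rule operation1I[OF assms(1) sum evens odds])
    then show ?thesis
      unfolding partition_equiv_def by (intro r_into_equivclp) simp
  next
    assume "odd_factor S (count p) = [:1, 0, 1:] * odd_factor S (count q)"
      "even_factor S (count q) = [:1, 0, 1:] * even_factor S (count p)"
    then show ?thesis
      by (rule exceptional_equiv[OF S assms sum])
  next
    assume "odd_factor S (count q) = [:1, 0, 1:] * odd_factor S (count p)"
      "even_factor S (count p) = [:1, 0, 1:] * even_factor S (count q)"
    then have "q \<sim>\<^sub>p p"
      by (rule exceptional_equiv[OF S(1-5,7,6) assms(2,1) sum[symmetric]])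
    then show ?thesis by (rule partition_equiv_sym)
  qed
qed (rule partition_poly_invariant)

end
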